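(* Let $n\ge 6$ and let $Q\subseteq\mathbb{R}^d$, with linear map $p$, be a weakly symmetric subspace extension of the permutahedron $\Pi_n$ with $d<\frac{n(n-1)}{2}$, with respect to $G=S_n$, and let $s=(s_1,\dots,s_d):X\to Q$ be a section as in the definition of weak symmetry. Then there exists a partition of $\{1,\dots,d\}$ into sets $\mathcal{A}_i$ and $\mathcal{B}_j$ such that each $\mathcal{B}_j$ consists of a single element $b_j$ and each $\mathcal{A}_i$ consists of $n$ elements $a^i_1,a^i_2,\dots,a^i_n$, with $$s_{a^i_t}(\pi.x)=s_{a^i_{\pi^{-1}(t)}}(x)\qquad\text{and}\qquad s_{b_j}(\pi.x)=s_{b_j}(x)$$ for every vertex $x\in X$, every $t\in\{1,\dots,n\}$, all $i,j$, and all $\pi\in A_n$.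
   Context: $\Pi_n$ is the convex hull of all coordinate permutations of $(1,2,\dots,n)$, with vertex set $X=\{(\zeta^{-1}(1),\dots,\zeta^{-1}(n)):\zeta\in S_n\}$. $S_n$ acts on $\mathbb{R}^n$ by $(\pi.x)_v=x_{\pi^{-1}(v)}$ and $S_d$ acts on $\mathbb{R}^d$ by $(\varkappa.y)_j=y_{\varkappa^{-1}(j)}$. A subspace extension of $\Pi_n$ is a set $Q\subseteq\mathbb{R}^d$ that is the intersection of an affine subspace with $\mathbb{R}^d_+$, together with a linear map $p:\mathbb{R}^d\to\mathbb{R}^n$ with $p(Q)=\Pi_n$. A section is a map $s:X\to Q$ with $p(s(x))=x$; the extension is weakly symmetric if there is a section $s$ such that for each $\pi\in S_n$ there is $\varkappa_\pi\in S_d$ with $s(\pi.x)=\varkappa_\pi.s(x)$ for all $x\in X$. $A_n$ denotes the alternating group on $\{1,\dots,n\}$. *)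

theory Defs
  imports "HOL-Analysis.Analysis" "HOL-Combinatorics.Permutations"
begin

text \<open>R^n is modelled as real^'n with n = CARD('n); the coordinate index type 'n
  plays the role of {1..n}. Likewise R^d is real^'d with d = CARD('d).\<close>

definition perm_act :: "('i::finite \<Rightarrow> 'i) \<Rightarrow> real^'i \<Rightarrow> real^'i" where
  "perm_act \<pi> x = (\<chi> v. x $ (inv \<pi> v))"

text \<open>Vertex set of the permutahedron: vectors whose coordinates are a permutation
  of 1,...,n (i.e. (zeta^-1(1),...,zeta^-1(n)) for zeta in S_n).\<close>
definition perm_vertices :: "(real^'n::finite) set" where
  "perm_vertices = {x. \<exists>f. bij_betw f (UNIV::'n set) {1..CARD('n)} \<and> (\<forall>v. x $ v = real (f v))}"

definition permutahedron :: "(real^'n::finite) set" where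
  "permutahedron = convex hull perm_vertices"

definition subspace_extension :: "(real^'d::finite) set \<Rightarrow> (real^'d \<Rightarrow> real^'n::finite) \<Rightarrow> bool" where
  "subspace_extension Q p \<longleftrightarrow>
     (\<exists>A. affine A \<and> Q = A \<inter> {y. \<forall>i. 0 \<le> y $ i}) \<and> linear p \<and> p ` Q = permutahedron"

definition weakly_symmetric_section ::
  "(real^'d::finite) set \<Rightarrow> (real^'d \<Rightarrow> real^'n::finite) \<Rightarrow> (real^'n \<Rightarrow> real^'d) \<Rightarrow> bool" where
  "weakly_symmetric_section Q p s \<longleftrightarrow>
     (\<forall>x\<in>perm_vertices. s x \<in> Q \<and> p (s x) = x) \<and>
     (\<forall>\<pi>. \<pi> permutes (UNIV::'n set) \<longrightarrow>
        (\<exists>\<kappa>. \<kappa> permutes (UNIV::'d set) \<and>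
           (\<forall>x\<in>perm_vertices. s (perm_act \<pi> x) = perm_act \<kappa> (s x))))"

end

theory Submission
  imports Defs
begin

text \<open>
  The hypotheses are contradictory: a weakly symmetric extension has \<open>2 d \<ge> n (n - 1)\<close>.
  Regard the coordinates of the section as functions \<open>g\<close> on the bijections \<open>V \<rightarrow> {1..n}\<close>; the symmetric
  group permutes them. For every \<open>1 \<le> j < n\<close> some \<open>g\<close> must vanish on the facet of a \<open>j\<close>-set \<open>S\<close>, but not
  on some vertex next to it. We bound the number of such \<open>j\<close> for a single orbit \<open>O\<close> of coordinates by
  \<open>2 |O| / n\<close>, unless already \<open>2 |O| \<ge> n (n - 1)\<close>.

  Such a \<open>j\<close> forces the stabilizer \<open>U\<close> of \<open>g\<close> to be intransitive on \<open>j\<close>-subsets. If \<open>U\<close> is transitive on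
  \<open>i\<close>-subsets for \<open>i < j\<close> but not for \<open>i = j\<close>, the permutation module of \<open>O\<close> contains the Specht module of
  shape \<open>(n - j, j)\<close>, so \<open>|O| \<ge> (n choose j) - (n choose (j - 1))\<close>, which suffices for \<open>j \<ge> 2\<close>.
  If \<open>U\<close> is intransitive on points, then either \<open>|O| \<ge> (n choose 2)\<close>, or \<open>U\<close> fixes a point \<open>v\<close>; in the
  latter case the same dimension bound on \<open>V - {v}\<close> lets us assume that \<open>U\<close> is transitive on the
  \<open>i\<close>-subsets of \<open>V - {v}\<close> for all \<open>i\<close>. Then \<open>j + 1\<close> is the smallest or \<open>j\<close> is the largest label of \<open>v\<close> on the
  support of \<open>g\<close>, so there are at most two such \<open>j\<close>, while \<open>|O| \<ge> n\<close>.
\<close>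

section \<open>Linear systems with more unknowns than equations\<close>

text \<open>Gaussian elimination: an equation with a nonzero coefficient at \<open>a0\<close> is
  solved for that unknown, which no longer occurs in the modified system \<open>M'\<close>.\<close>

lemma underdetermined_system_nontrivial_solution:
  fixes M :: "'b \<Rightarrow> 'a \<Rightarrow> real"
  assumes "finite B" "finite A" "card B < card A"
  shows "\<exists>w. (\<exists>a\<in>A. w a \<noteq> 0) \<and> (\<forall>b\<in>B. (\<Sum>a\<in>A. M b a * w a) = 0)"
  using assms
proof (induction B arbitrary: A M rule: finite_induct)
  case empty
  then obtain a where "a \<in> A" by fastforce
  then show ?case by (intro exI[of _ "\<lambda>_. 1"]) auto
next
  case (insert b B)
  show ?case
  proof (cases "\<forall>a\<in>A. M b a = 0")
    case True
    obtain w where "\<exists>a\<in>A. w a \<noteq> 0" "\<forall>b\<in>B. (\<Sum>a\<in>A. M b a * w a) = 0"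
      using insert.IH[of A M] insert.prems insert.hyps by auto
    with True show ?thesis by (intro exI[of _ w]) simp
  next
    case False
    then obtain a0 where a0: "a0 \<in> A" "M b a0 \<noteq> 0" by blast
    define M' where "M' = (\<lambda>b' a. M b' a - M b' a0 / M b a0 * M b a)"
    have "card B < card (A - {a0})" using insert a0 by simp
    then obtain w where w: "\<exists>a\<in>A - {a0}. w a \<noteq> 0"
      "\<And>b'. b' \<in> B \<Longrightarrow> (\<Sum>a\<in>A - {a0}. M' b' a * w a) = 0"
      using insert.IH[of "A - {a0}" M'] insert.prems by auto
    define w' where "w' = w(a0 := - (\<Sum>a\<in>A - {a0}. M b a * w a) / M b a0)"
    have eq: "(\<Sum>a\<in>A. M b' a * w' a) =
        (\<Sum>a\<in>A - {a0}. M b' a * w a) - M b' a0 / M b a0 * (\<Sum>a\<in>A - {a0}. M b a * w a)" for b'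
    proof -
      have "(\<Sum>a\<in>A. M b' a * w' a) = M b' a0 * w' a0 + (\<Sum>a\<in>A - {a0}. M b' a * w' a)"
        using insert.prems(1) a0(1) by (rule sum.remove)
      also have "(\<Sum>a\<in>A - {a0}. M b' a * w' a) = (\<Sum>a\<in>A - {a0}. M b' a * w a)"
        by (intro sum.cong) (auto simp: w'_def)
      finally show ?thesis by (simp add: w'_def)
    qed
    have "(\<Sum>a\<in>A. M b' a * w' a) = 0" if "b' \<in> B" for b'
      using w(2)[OF that] unfolding eq
      by (simp add: M'_def algebra_simps sum_subtractf sum_distrib_left)
    moreover have "(\<Sum>a\<in>A. M b a * w' a) = 0"
      using a0(2) unfolding eq by simp
    moreover have "\<exists>a\<in>A. w' a \<noteq> 0"
      using w(1) by (auto simp: w'_def)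
    ultimately show ?thesis by blast
  qed
qed

section \<open>Harmonic functions on subsets of fixed size\<close>

definition subsets_of_card :: "'a set \<Rightarrow> nat \<Rightarrow> 'a set set" where
  "subsets_of_card V j = {T. T \<subseteq> V \<and> card T = j}"

lemma finite_subsets_of_card [simp]: "finite V \<Longrightarrow> finite (subsets_of_card V j)"
  by (simp add: subsets_of_card_def)

lemma card_subsets_of_card [simp]: "finite V \<Longrightarrow> card (subsets_of_card V j) = card V choose j"
  by (simp add: subsets_of_card_def n_subsets)

lemma image_permutes_subsets_of_card:
  assumes "\<pi> permutes V" "T \<in> subsets_of_card V j"
  shows "\<pi> ` T \<in> subsets_of_card V j"
  using assms by (auto simp: subsets_of_card_def permutes_in_image card_image permutes_inj_on)

lemma bij_betw_image_subsets_of_card: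
  assumes "\<pi> permutes V"
  shows "bij_betw ((`) \<pi>) (subsets_of_card V j) (subsets_of_card V j)"
proof (rule bij_betw_byWitness[where f' = "(`) (inv \<pi>)"])
  show "(`) \<pi> ` subsets_of_card V j \<subseteq> subsets_of_card V j"
    "(`) (inv \<pi>) ` subsets_of_card V j \<subseteq> subsets_of_card V j"
    using image_permutes_subsets_of_card assms permutes_inv by blast+
qed (simp_all add: image_image permutes_inverses[OF assms])

lemma insert_in_subsets_of_card:
  assumes "finite V" "R \<in> subsets_of_card V j" "z \<in> V - R"
  shows "insert z R \<in> subsets_of_card V (Suc j)"
  using assms by (auto simp: subsets_of_card_def card_insert_if dest: finite_subset)

lemma subsets_of_card_Suc_cases:
  assumes "T \<in> subsets_of_card V (Suc j)"
  obtains z R where "R \<in> subsets_of_card V j" "z \<in> V - R" "T = insert z R"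
proof -
  obtain z R where "T = insert z R" "z \<notin> R" "card R = j"
    using assms by (auto simp: subsets_of_card_def card_Suc_eq)
  with assms show thesis by (intro that[of R z]) (auto simp: subsets_of_card_def)
qed

text \<open>The harmonic functions on \<open>j\<close>-subsets form the Specht module of shape \<open>(n - j, j)\<close>.\<close>

definition harmonic :: "'a set \<Rightarrow> nat \<Rightarrow> ('a set \<Rightarrow> real) \<Rightarrow> bool" where
  "harmonic V j w \<longleftrightarrow> (\<forall>R. R \<subseteq> V \<and> Suc (card R) = j \<longrightarrow> (\<Sum>z\<in>V - R. w (insert z R)) = 0)"

lemma harmonicD:
  "harmonic V (Suc j) w \<Longrightarrow> R \<in> subsets_of_card V j \<Longrightarrow> (\<Sum>z\<in>V - R. w (insert z R)) = 0"
  by (auto simp: harmonic_def subsets_of_card_def)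

lemma harmonic_permute:
  assumes "harmonic V j w" "\<pi> permutes V"
  shows "harmonic V j (\<lambda>T. w (\<pi> ` T))"
  unfolding harmonic_def
proof (intro allI impI)
  fix R assume R: "R \<subseteq> V \<and> Suc (card R) = j"
  have "(\<Sum>z\<in>V - R. w (\<pi> ` insert z R)) = (\<Sum>z\<in>\<pi> ` (V - R). w (insert z (\<pi> ` R)))"
    using assms(2) by (simp add: sum.reindex permutes_inj_on)
  also have "\<pi> ` (V - R) = V - \<pi> ` R"
    using assms(2) by (simp add: image_set_diff permutes_inj permutes_image)
  also have "(\<Sum>z\<in>V - \<pi> ` R. w (insert z (\<pi> ` R))) = 0"
    proof -
    have "\<pi> ` R \<subseteq> V" "Suc (card (\<pi> ` R)) = j"
      using R assms(2) by (auto simp: card_image permutes_inj_on permutes_in_image)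
    with assms(1) show ?thesis unfolding harmonic_def by blast
  qed
  finally show "(\<Sum>z\<in>V - R. w (\<pi> ` insert z R)) = 0" .
qed

text \<open>If \<open>w\<close> were constant on the sets \<open>insert z R\<close>, the harmonic
  condition at \<open>R\<close> would give \<open>card (V - R) * w T = 0\<close>.\<close>

lemma harmonic_nonzero_exchange:
  assumes "finite V" "harmonic V (Suc j) w" "T \<in> subsets_of_card V (Suc j)" "w T \<noteq> 0"
  obtains a b R where "a \<in> V" "b \<in> V" "a \<noteq> b" "R \<in> subsets_of_card (V - {a, b}) j"
    "w (insert a R) \<noteq> w (insert b R)"
proof -
  obtain a R where R: "R \<in> subsets_of_card V j" "a \<in> V - R" "T = insert a R"
    using assms(3) by (rule subsets_of_card_Suc_cases)
  have "\<exists>b\<in>V - R. w (insert b R) \<noteq> w (insert a R)"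
  proof (rule ccontr)
    assume "\<not> ?thesis"
    then have "(\<Sum>z\<in>V - R. w (insert z R)) = (\<Sum>z\<in>V - R. w (insert a R))"
      by (intro sum.cong) auto
    with harmonicD[OF assms(2) R(1)] have "card (V - R) = 0 \<or> w T = 0"
      by (simp add: R(3))
    with assms R show False by auto
  qed
  then obtain b where "b \<in> V - R" "w (insert b R) \<noteq> w (insert a R)" by blast
  with R show thesis
    by (intro that[of a b R]) (auto simp: subsets_of_card_def)
qed

definition exchange :: "'a \<Rightarrow> 'a \<Rightarrow> ('a set \<Rightarrow> real) \<Rightarrow> 'a set \<Rightarrow> real" where
  "exchange a b w R = w (insert a R) - w (insert b R)"

text \<open>The harmonic conditions at \<open>insert a R\<close> and \<open>insert b R\<close> give
  both sums over \<open>V - {a, b} - R\<close> the same value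
  \<open>- w (insert a (insert b R))\<close>.\<close>

lemma harmonic_exchange:
  assumes "finite V" "harmonic V (Suc j) w" "a \<in> V" "b \<in> V" "a \<noteq> b"
  shows "harmonic (V - {a, b}) j (exchange a b w)"
  unfolding harmonic_def
proof (intro allI impI)
  fix R assume R: "R \<subseteq> V - {a, b} \<and> Suc (card R) = j"
  then have finR: "finite R" using assms(1) by (auto dest: finite_subset)
  have sum_c: "(\<Sum>z\<in>V - {a, b} - R. w (insert c (insert z R))) = - w (insert a (insert b R))"
    if c: "c = a \<and> c' = b \<or> c = b \<and> c' = a" for c c'
  proof -
    have "0 = (\<Sum>z\<in>V - insert c R. w (insert z (insert c R)))"
    proof -
      have "c \<notin> R" "c \<in> V" using R c assms by auto
      then have "insert c R \<in> subsets_of_card V j"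
        using R finR by (auto simp: subsets_of_card_def)
      then show ?thesis using harmonicD[OF assms(2)] by simp
    qed
    also have "V - insert c R = insert c' (V - {a, b} - R)"
      using c R assms by auto
    also have "(\<Sum>z\<in>\<dots>. w (insert z (insert c R))) =
        w (insert c' (insert c R)) + (\<Sum>z\<in>V - {a, b} - R. w (insert z (insert c R)))"
      using c assms(1) by (subst sum.insert) auto
    finally show ?thesis using c by (auto simp: insert_commute)
  qed
  show "(\<Sum>z\<in>V - {a, b} - R. exchange a b w (insert z R)) = 0"
    using sum_c[of a b] sum_c[of b a] by (simp add: exchange_def sum_subtractf)
qed

abbreviation (input) swap :: "'a \<Rightarrow> 'a \<Rightarrow> 'a \<Rightarrow> 'a" where
  "swap \<equiv> Transposition.transpose"

text \<open>A set containing both or neither of \<open>a\<close> and \<open>b\<close> is fixed by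
  the transposition and contributes nothing. The others form pairs \<open>insert a R\<close>,
  \<open>insert b R\<close>, whose two terms combine to one product.\<close>

lemma sum_subsets_exchange:
  assumes "finite V" "a \<in> V" "b \<in> V" "a \<noteq> b"
  shows "(\<Sum>T\<in>subsets_of_card V (Suc j). (w T - w (swap a b ` T)) * u T) =
    (\<Sum>R\<in>subsets_of_card (V - {a, b}) j. exchange a b w R * exchange a b u R)"
proof -
  let ?S = "subsets_of_card (V - {a, b}) j"
  let ?h = "\<lambda>T. (w T - w (swap a b ` T)) * u T"
  have S: "a \<notin> R" "b \<notin> R" "finite R" "card R = j" "R \<subseteq> V" if "R \<in> ?S" for R
    using that assms(1) by (auto simp: subsets_of_card_def dest: finite_subset)
  have tr: "swap a b ` insert a R = insert b R" "swap a b ` insert b R = insert a R"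
    if "R \<in> ?S" for R
  proof -
    have "swap a b ` R = R" using S[OF that] by (auto simp: Transposition.transpose_def image_iff)
    then show "swap a b ` insert a R = insert b R" "swap a b ` insert b R = insert a R"
      by auto
  qed
  have "sum ?h (subsets_of_card V (Suc j)) = sum ?h (insert a ` ?S \<union> insert b ` ?S)"
  proof (rule sum.mono_neutral_right)
    show "insert a ` ?S \<union> insert b ` ?S \<subseteq> subsets_of_card V (Suc j)"
    proof -
      have "insert c R \<in> subsets_of_card V (Suc j)" if "R \<in> ?S" "c \<in> {a, b}" for R c
        using S[OF that(1)] that(2) assms(2,3) by (auto simp: subsets_of_card_def)
      then show ?thesis by blast
    qed
    show "\<forall>T\<in>subsets_of_card V (Suc j) - (insert a ` ?S \<union> insert b ` ?S). ?h T = 0"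
    proof
      fix T assume T: "T \<in> subsets_of_card V (Suc j) - (insert a ` ?S \<union> insert b ` ?S)"
      have "T \<in> insert c ` ?S" if "c \<in> T" "c' \<notin> T" "{c, c'} = {a, b}" for c c'
      proof
        show "T = insert c (T - {c})" using that(1) by blast
        have "T - {c} \<subseteq> V - {c, c'}" "card (T - {c}) = j"
          using that(1,2) T by (auto simp: subsets_of_card_def)
        then show "T - {c} \<in> ?S" by (simp add: subsets_of_card_def that(3))
      qed
      from this[of a b] this[of b a] T have "a \<in> T \<longleftrightarrow> b \<in> T" by (metis DiffD2 UnCI insert_commute)
      then have "swap a b ` T = T" by (auto simp: Transposition.transpose_def image_iff)
      then show "?h T = 0" by simp
    qed
  qed (use assms in simp)
  also have "\<dots> = sum ?h (insert a ` ?S) + sum ?h (insert b ` ?S)"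
  proof (rule sum.union_disjoint)
    show "insert a ` ?S \<inter> insert b ` ?S = {}" using S assms(4) by (blast elim: equalityE)
  qed (use assms(1) in simp_all)
  also have "inj_on (insert a) ?S" "inj_on (insert b) ?S"
    using S by (metis inj_onI insert_ident)+
  then have "sum ?h (insert a ` ?S) + sum ?h (insert b ` ?S) =
      (\<Sum>R\<in>?S. ?h (insert a R)) + (\<Sum>R\<in>?S. ?h (insert b R))"
    by (simp add: sum.reindex)
  also have "\<dots> = (\<Sum>R\<in>?S. exchange a b w R * exchange a b u R)"
    unfolding sum.distrib[symmetric] by (intro sum.cong refl) (simp only: tr exchange_def, algebra)
  finally show ?thesis .
qed

lemma permutes_pair:
  assumes "a \<in> V" "b \<in> V" "c \<in> V" "d \<in> V" "a \<noteq> b" "c \<noteq> d"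
  obtains \<tau> where "\<tau> permutes V" "\<tau> a = c" "\<tau> b = d"
proof
  let ?\<tau> = "swap (swap a c b) d \<circ> swap a c"
  have "swap a c b \<in> V" using assms by (auto simp: Transposition.transpose_def)
  then show "?\<tau> permutes V" using assms by (intro permutes_compose permutes_swap_id)
  show "?\<tau> a = c" "?\<tau> b = d" using assms by (auto simp: Transposition.transpose_def)
qed

text \<open>Irreducibility of the Specht module, in the form that no two nonzero harmonic functions have
  orthogonal orbits. Passing to \<open>exchange a b\<close> lowers \<open>j\<close> because
  \<open>\<langle>(1 - (a b)) w, u\<rangle> = \<langle>exchange a b w, exchange a b u\<rangle>\<close>.\<close>

lemma harmonic_orbits_not_orthogonal:
  assumes "finite V" "2 * j \<le> card V" "harmonic V j w" "harmonic V j u"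
    "T \<in> subsets_of_card V j" "w T \<noteq> 0" "T' \<in> subsets_of_card V j" "u T' \<noteq> 0"
  shows "\<exists>\<pi>. \<pi> permutes V \<and> (\<Sum>T\<in>subsets_of_card V j. w (\<pi> ` T) * u T) \<noteq> 0"
  using assms
proof (induction j arbitrary: V w u T T')
  case 0
  have "subsets_of_card V 0 = {{}}"
    using 0 by (auto simp: subsets_of_card_def dest: finite_subset)
  moreover from this have "w {} * u {} \<noteq> 0"
    using 0(5-8) by simp
  ultimately have "(\<Sum>T\<in>subsets_of_card V 0. w (id ` T) * u T) \<noteq> 0" by simp
  then show ?case using permutes_id by blast
next
  case (Suc j)
  obtain c d R where w: "c \<in> V" "d \<in> V" "c \<noteq> d" "R \<in> subsets_of_card (V - {c, d}) j"
    "w (insert c R) \<noteq> w (insert d R)"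
    using Suc.prems harmonic_nonzero_exchange by metis
  obtain a b R' where u: "a \<in> V" "b \<in> V" "a \<noteq> b" "R' \<in> subsets_of_card (V - {a, b}) j"
    "u (insert a R') \<noteq> u (insert b R')"
    using Suc.prems harmonic_nonzero_exchange by metis
  \<comment> \<open>Pulling \<open>w\<close> back along \<open>\<tau>\<close> lets both functions be
    reduced along the same pair \<open>a\<close>, \<open>b\<close>.\<close>
  obtain \<tau> where \<tau>: "\<tau> permutes V" "\<tau> a = c" "\<tau> b = d"
    using permutes_pair w u by metis
  let ?V = "V - {a, b}"
  let ?w = "\<lambda>T. w (\<tau> ` T)"
  have "inv \<tau> ` R \<in> subsets_of_card ?V j"
  proof -
    have "inv \<tau> ` R \<in> subsets_of_card V j"
      using w(4) by (intro image_permutes_subsets_of_card permutes_inv[OF \<tau>(1)])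
        (auto simp: subsets_of_card_def)
    moreover have "a \<notin> inv \<tau> ` R" "b \<notin> inv \<tau> ` R"
      using w(4) \<tau> permutes_inverses(1)[OF \<tau>(1)] by (auto simp: subsets_of_card_def)
    ultimately show ?thesis by (auto simp: subsets_of_card_def)
  qed
  moreover have "exchange a b ?w (inv \<tau> ` R) \<noteq> 0"
    using w(5) \<tau> by (simp add: exchange_def image_image permutes_inverses(1)[OF \<tau>(1)])
  moreover have "exchange a b u R' \<noteq> 0" using u(5) by (simp add: exchange_def)
  moreover have "2 * j \<le> card ?V"
    using Suc.prems u by (simp add: card_Diff_subset)
  ultimately obtain \<rho> where \<rho>: "\<rho> permutes ?V"
    "(\<Sum>T\<in>subsets_of_card ?V j. exchange a b ?w (\<rho> ` T) * exchange a b u T) \<noteq> 0"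
    using Suc.IH[of ?V "exchange a b ?w" "exchange a b u"]
      harmonic_exchange[OF Suc.prems(1) harmonic_permute[OF Suc.prems(3) \<tau>(1)] u(1-3)]
      harmonic_exchange[OF Suc.prems(1) Suc.prems(4) u(1-3)] Suc.prems(1) u(4)
    by blast
  let ?\<pi> = "\<tau> \<circ> \<rho>"
  have \<pi>: "?\<pi> permutes V"
    using \<rho>(1) \<tau>(1) by (auto intro: permutes_compose permutes_subset)
  have "\<rho> a = a" "\<rho> b = b" using \<rho>(1) by (auto simp: permutes_def)
  then have "exchange a b ?w (\<rho> ` T) = exchange a b (\<lambda>T. w (?\<pi> ` T)) T" for T
    by (simp add: exchange_def image_comp)
  with \<rho>(2) have "(\<Sum>T\<in>subsets_of_card V (Suc j).
      (w (?\<pi> ` T) - w (?\<pi> ` swap a b ` T)) * u T) \<noteq> 0"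
    using sum_subsets_exchange[OF Suc.prems(1) u(1-3),
        where j = j and w = "\<lambda>T. w (?\<pi> ` T)" and u = u] by simp
  then have "(\<Sum>T\<in>subsets_of_card V (Suc j). w (?\<pi> ` T) * u T) \<noteq> 0 \<or>
      (\<Sum>T\<in>subsets_of_card V (Suc j). w ((?\<pi> \<circ> swap a b) ` T) * u T) \<noteq> 0"
    by (auto simp: left_diff_distrib sum_subtractf image_comp comp_assoc)
  moreover have "?\<pi> \<circ> swap a b permutes V"
    using permutes_compose[OF permutes_swap_id \<pi>] u(1,2) by blast
  ultimately show ?case using \<pi> by blast
qed

text \<open>Otherwise some nonzero \<open>w\<close> is orthogonal to every \<open>c i\<close> and to
  the indicator of the supersets of each \<open>j\<close>-set. The latter makes \<open>w\<close>
  harmonic; by closedness \<open>w\<close> is orthogonal to all translates of \<open>c i0\<close>,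
  contradicting \<open>harmonic_orbits_not_orthogonal\<close>.\<close>

lemma binomial_le_card_of_harmonic_family:
  fixes c :: "'i \<Rightarrow> 'a set \<Rightarrow> real"
  assumes "finite V" "2 * Suc j \<le> card V" "finite I"
    and closed: "\<And>i \<pi>. i \<in> I \<Longrightarrow> \<pi> permutes V \<Longrightarrow>
      \<exists>i'\<in>I. \<forall>T\<in>subsets_of_card V (Suc j). c i (\<pi> ` T) = c i' T"
    and i0: "i0 \<in> I" "harmonic V (Suc j) (c i0)" "T0 \<in> subsets_of_card V (Suc j)" "c i0 T0 \<noteq> 0"
  shows "card V choose Suc j \<le> (card V choose j) + card I"
proof (rule ccontr)
  let ?A = "subsets_of_card V (Suc j)" and ?B = "subsets_of_card V j <+> I"
  let ?M = "case_sum (\<lambda>R T. of_bool (R \<subseteq> T)) c"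
  assume "\<not> ?thesis"
  then have "card ?B < card ?A" using assms by (simp add: card_Plus)
  then obtain w where w: "\<exists>T\<in>?A. w T \<noteq> 0" "\<And>b. b \<in> ?B \<Longrightarrow> (\<Sum>T\<in>?A. ?M b T * w T) = 0"
    using underdetermined_system_nontrivial_solution[of ?B ?A ?M] assms(1,3) by (auto simp del: Plus_def)
  have "harmonic V (Suc j) w"
    unfolding harmonic_def
  proof (intro allI impI)
    fix R assume "R \<subseteq> V \<and> Suc (card R) = Suc j"
    then have R: "R \<in> subsets_of_card V j" by (simp add: subsets_of_card_def)
    then have finR: "finite R" using assms(1) by (auto simp: subsets_of_card_def dest: finite_subset)
    have img: "(\<lambda>z. insert z R) ` (V - R) = {T \<in> ?A. R \<subseteq> T}"
    proof (intro equalityI subsetI)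
      fix T assume T: "T \<in> {T \<in> ?A. R \<subseteq> T}"
      then have "card (T - R) = 1"
        using R finR by (simp add: subsets_of_card_def card_Diff_subset)
      then obtain z where z: "T - R = {z}" by (rule card_1_singletonE)
      with T have "T = insert z R" "z \<in> V - R" by (auto simp: subsets_of_card_def)
      then show "T \<in> (\<lambda>z. insert z R) ` (V - R)" by blast
    qed (use R assms(1) insert_in_subsets_of_card in fastforce)
    have "0 = (\<Sum>T\<in>?A. of_bool (R \<subseteq> T) * w T)"
      using w(2)[OF InlI[OF R]] by simp
    also have "\<dots> = (\<Sum>T\<in>{T \<in> ?A. R \<subseteq> T}. w T)"
      using assms(1) by (intro sum.mono_neutral_cong_right) auto
    also have "\<dots> = (\<Sum>z\<in>V - R. w (insert z R))"
      unfolding img[symmetric] by (subst sum.reindex) (auto simp: inj_on_def)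
    finally show "(\<Sum>z\<in>V - R. w (insert z R)) = 0" by simp
  qed
  then obtain \<pi> where \<pi>: "\<pi> permutes V" "(\<Sum>T\<in>?A. w (\<pi> ` T) * c i0 T) \<noteq> 0"
    using harmonic_orbits_not_orthogonal[of V "Suc j" w "c i0"] assms w(1) by blast
  obtain i' where i': "i' \<in> I" "\<And>T. T \<in> ?A \<Longrightarrow> c i0 (inv \<pi> ` T) = c i' T"
    using closed[OF i0(1) permutes_inv[OF \<pi>(1)]] by blast
  have "(\<Sum>T\<in>?A. w (\<pi> ` T) * c i0 T) = (\<Sum>T\<in>?A. w (\<pi> ` T) * c i' (\<pi> ` T))"
  proof (intro sum.cong refl)
    fix T assume "T \<in> ?A"
    then have "c i' (\<pi> ` T) = c i0 (inv \<pi> ` \<pi> ` T)"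
      using i'(2) image_permutes_subsets_of_card[OF \<pi>(1)] by simp
    also have "inv \<pi> ` \<pi> ` T = T" by (simp add: image_image permutes_inverses(2)[OF \<pi>(1)])
    finally show "w (\<pi> ` T) * c i0 T = w (\<pi> ` T) * c i' (\<pi> ` T)" by simp
  qed
  also have "\<dots> = (\<Sum>T\<in>?A. w T * c i' T)"
    using bij_betw_image_subsets_of_card[OF \<pi>(1)] by (rule sum.reindex_bij_betw)
  also have "\<dots> = 0" using w(2)[OF InrI[OF i'(1)]] by (simp add: mult.commute)
  finally show False using \<pi>(2) by simp
qed

section \<open>Orbits of the symmetric group and lower bounds on their size\<close>

lemma permutes_with_image:
  assumes "finite V" "S \<in> subsets_of_card V i" "S' \<in> subsets_of_card V i"
  obtains \<pi> where "\<pi> permutes V" "\<pi> ` S = S'"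
proof -
  have fin: "finite S" "finite S'" "S \<subseteq> V" "S' \<subseteq> V" "card S = card S'"
    using assms by (auto simp: subsets_of_card_def dest: finite_subset)
  then obtain f where f: "bij_betw f S S'"
    using finite_same_card_bij by blast
  have "card (V - S) = card (V - S')" using fin assms(1) by (simp add: card_Diff_subset)
  then obtain g where g: "bij_betw g (V - S) (V - S')"
    using finite_same_card_bij assms(1) by (metis finite_Diff)
  define \<pi> where "\<pi> = (\<lambda>x. if x \<in> V then (if x \<in> S then f x else g x) else x)"
  have "bij_betw \<pi> S S'"
    using f by (rule bij_betw_cong[THEN iffD1, rotated]) (use fin in \<open>auto simp: \<pi>_def\<close>)
  moreover have "bij_betw \<pi> (V - S) (V - S')"
    using g by (rule bij_betw_cong[THEN iffD1, rotated]) (auto simp: \<pi>_def)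
  ultimately have "bij_betw \<pi> (S \<union> (V - S)) (S' \<union> (V - S'))"
    by (rule bij_betw_combine) auto
  moreover have "S \<union> (V - S) = V" "S' \<union> (V - S') = V" using fin by auto
  ultimately have "bij_betw \<pi> V V" by simp
  then have "\<pi> permutes V"
    by (rule bij_imp_permutes) (simp add: \<pi>_def)
  with \<open>bij_betw \<pi> S S'\<close> show thesis by (intro that) (auto simp: bij_betw_def)
qed

text \<open>\<open>\<phi> \<pi>\<close> plays the role of the translate of a fixed object by \<open>\<pi>\<close> under some left action of the
  symmetric group of \<open>V\<close>, so that the orbit of the object is the range of \<open>\<phi>\<close>.\<close>

locale orbit_map =
  fixes V :: "'a set" and \<phi> :: "('a \<Rightarrow> 'a) \<Rightarrow> 'o"
  assumes finite_V: "finite V"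
    and translate_cong: "\<And>\<sigma> \<pi> \<pi>'. \<sigma> permutes V \<Longrightarrow> \<pi> permutes V \<Longrightarrow> \<pi>' permutes V \<Longrightarrow>
      \<phi> \<pi> = \<phi> \<pi>' \<Longrightarrow> \<phi> (\<sigma> \<circ> \<pi>) = \<phi> (\<sigma> \<circ> \<pi>')"
begin

definition orbit :: "'o set" where
  "orbit = \<phi> ` {\<pi>. \<pi> permutes V}"

definition stabilizer :: "('a \<Rightarrow> 'a) set" where
  "stabilizer = {\<pi>. \<pi> permutes V \<and> \<phi> \<pi> = \<phi> id}"

definition homogeneous :: "nat \<Rightarrow> bool" where
  "homogeneous i \<longleftrightarrow>
     (\<forall>S\<in>subsets_of_card V i. \<forall>S'\<in>subsets_of_card V i. \<exists>u\<in>stabilizer. u ` S = S')"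

lemma finite_orbit: "finite orbit"
  by (simp add: orbit_def finite_V finite_permutations)

lemma id_in_stabilizer: "id \<in> stabilizer"
  by (simp add: stabilizer_def permutes_id)

lemma stabilizer_permutes: "u \<in> stabilizer \<Longrightarrow> u permutes V"
  by (simp add: stabilizer_def)

lemma stabilizer_comp:
  assumes "u \<in> stabilizer" "u' \<in> stabilizer"
  shows "u \<circ> u' \<in> stabilizer"
  using assms translate_cong[of u u' id]
  by (auto simp: stabilizer_def permutes_id intro: permutes_compose)

lemma translate_eq_imp_stabilizer:
  assumes "\<pi> permutes V" "\<pi>' permutes V" "\<phi> \<pi> = \<phi> \<pi>'"
  shows "inv \<pi> \<circ> \<pi>' \<in> stabilizer"
  using translate_cong[OF permutes_inv[OF assms(1)] assms(1,2,3)] assms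
  by (simp add: stabilizer_def permutes_inv_o permutes_compose permutes_inv)

lemma stabilizer_inv:
  assumes "u \<in> stabilizer"
  shows "inv u \<in> stabilizer"
  using translate_eq_imp_stabilizer[of u id] assms by (simp add: stabilizer_def permutes_id)

lemma homogeneous_0: "homogeneous 0"
proof -
  have "subsets_of_card V 0 = {{}}"
    using finite_V by (auto simp: subsets_of_card_def dest: finite_subset)
  then show ?thesis using id_in_stabilizer by (auto simp: homogeneous_def)
qed

lemma homogeneous_complement:
  assumes "homogeneous i" "i \<le> card V"
  shows "homogeneous (card V - i)"
  unfolding homogeneous_def
proof (intro ballI)
  have compl: "V - S \<in> subsets_of_card V i" if "S \<in> subsets_of_card V (card V - i)" for S
    using that assms(2) finite_V
    by (auto simp: subsets_of_card_def card_Diff_subset finite_subset)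
  fix S S' assume S: "S \<in> subsets_of_card V (card V - i)" "S' \<in> subsets_of_card V (card V - i)"
  then obtain u where u: "u \<in> stabilizer" "u ` (V - S) = V - S'"
    using assms(1) compl unfolding homogeneous_def by blast
  then have up: "u permutes V" by (simp add: stabilizer_permutes)
  have "S \<subseteq> V" "S' \<subseteq> V" using S by (auto simp: subsets_of_card_def)
  moreover have "u ` (V - S) = V - u ` S"
    using up by (simp add: image_set_diff permutes_inj permutes_image)
  moreover have "u ` S \<subseteq> V" using \<open>S \<subseteq> V\<close> up by (auto simp: permutes_in_image)
  ultimately have "u ` S = S'" using u(2) double_diff[of _ V V] by (metis order_refl)
  with u(1) show "\<exists>u\<in>stabilizer. u ` S = S'" by blast
qed

lemma homogeneous_beyond: "card V < i \<Longrightarrow> homogeneous i"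
  using finite_V by (auto simp: homogeneous_def subsets_of_card_def dest: card_mono)

text \<open>\<open>Suc j\<close> is the least inhomogeneous size. Complements of inhomogeneous sizes
  are inhomogeneous, so \<open>Suc j\<close> is also at most \<open>card V - k\<close>; taking
  \<open>k = Suc j\<close> bounds \<open>2 * Suc j\<close>.\<close>

lemma first_inhomogeneous:
  assumes "\<not> homogeneous i"
  obtains j where "homogeneous j" "\<not> homogeneous (Suc j)" "2 * Suc j \<le> card V"
    "\<And>k. \<not> homogeneous k \<Longrightarrow> Suc j \<le> k \<and> k + Suc j \<le> card V"
proof -
  define m where "m = (LEAST k. \<not> homogeneous k)"
  have m: "\<not> homogeneous m" unfolding m_def using assms by (rule LeastI)
  have least: "m \<le> k" if "\<not> homogeneous k" for k
    unfolding m_def using that by (rule Least_le)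
  have range: "m \<le> k \<and> k + m \<le> card V" if "\<not> homogeneous k" for k
  proof -
    have k: "k \<le> card V" using that homogeneous_beyond not_le by blast
    then have "\<not> homogeneous (card V - k)"
      using that homogeneous_complement[of "card V - k"] by auto
    with least[OF this] least[OF that] k show ?thesis by auto
  qed
  obtain j where j: "m = Suc j" using m homogeneous_0 by (cases m) auto
  have "homogeneous j" using least[of j] j by fastforce
  then show thesis
    using m j range[OF m] range by (intro that[of j]) auto
qed

text \<open>The stabilizer orbit of \<open>S0\<close> misses \<open>S1\<close>, so its indicator is
  not constant. By \<open>homogeneous j\<close> every \<open>j\<close>-set lies in equally many
  members, hence subtracting a constant makes the indicator harmonic. Its translates form a family
  indexed by \<open>orbit\<close>.\<close>

lemma card_orbit_ge_of_inhomogeneous: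
  assumes hom: "homogeneous j" and inhom: "\<not> homogeneous (Suc j)" and le: "2 * Suc j \<le> card V"
  shows "card V choose Suc j \<le> (card V choose j) + card orbit"
proof -
  obtain S0 S1 where S: "S0 \<in> subsets_of_card V (Suc j)" "S1 \<in> subsets_of_card V (Suc j)"
    "\<And>u. u \<in> stabilizer \<Longrightarrow> u ` S0 \<noteq> S1"
    using inhom unfolding homogeneous_def by blast
  \<comment> \<open>For a permutation \<open>\<pi>\<close> of \<open>V\<close>,
    \<open>fam (\<phi> \<pi>)\<close> is the translate by \<open>\<pi>\<close> of the stabilizer
    orbit of \<open>S0\<close>; it depends on \<open>\<phi> \<pi>\<close> only.\<close>
  define fam where "fam = (\<lambda>i. {\<pi> ` S0 |\<pi>. \<pi> permutes V \<and> \<phi> \<pi> = i})"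
  have fam_id: "fam (\<phi> id) = {u ` S0 |u. u \<in> stabilizer}"
    by (auto simp: fam_def stabilizer_def)
  have fam_translate: "\<sigma> ` T \<in> fam (\<phi> (\<sigma> \<circ> \<pi>))"
    if \<sigma>: "\<sigma> permutes V" and \<pi>: "\<pi> permutes V" and T: "T \<in> fam (\<phi> \<pi>)" for \<sigma> \<pi> T
  proof -
    obtain \<pi>' where \<pi>': "T = \<pi>' ` S0" "\<pi>' permutes V" "\<phi> \<pi>' = \<phi> \<pi>"
      using T by (auto simp: fam_def)
    then have "\<phi> (\<sigma> \<circ> \<pi>') = \<phi> (\<sigma> \<circ> \<pi>)" using translate_cong \<sigma> \<pi> by blast
    moreover have "\<sigma> \<circ> \<pi>' permutes V" using \<pi>' \<sigma> by (simp add: permutes_compose)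
    moreover have "\<sigma> ` T = (\<sigma> \<circ> \<pi>') ` S0" by (simp add: \<pi>'(1) image_comp)
    ultimately show ?thesis unfolding fam_def by blast
  qed
  have fam_stab: "u ` T \<in> fam (\<phi> id) \<longleftrightarrow> T \<in> fam (\<phi> id)" if u: "u \<in> stabilizer" for u T
  proof -
    have *: "v ` T \<in> fam (\<phi> id)" if "v \<in> stabilizer" "T \<in> fam (\<phi> id)" for v T
      using fam_translate[of v id T] that by (auto simp: stabilizer_def permutes_id)
    have "inv u ` u ` T = T"
      by (simp add: image_image permutes_inverses(2)[OF stabilizer_permutes[OF u]])
    with *[OF stabilizer_inv[OF u]] *[OF u] show ?thesis by metis
  qed
  define deg where "deg = (\<lambda>R. card {z \<in> V - R. insert z R \<in> fam (\<phi> id)})"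
  have deg_eq: "deg R = deg R'" if R: "R \<in> subsets_of_card V j" "R' \<in> subsets_of_card V j" for R R'
  proof -
    obtain u where u: "u \<in> stabilizer" "u ` R = R'"
      using hom R unfolding homogeneous_def by blast
    then have up: "u permutes V" by (simp add: stabilizer_permutes)
    have img: "u ` {z \<in> V - R. insert z R \<in> fam (\<phi> id)} = {z \<in> V - R'. insert z R' \<in> fam (\<phi> id)}"
    proof (intro equalityI subsetI)
      fix y assume y: "y \<in> {z \<in> V - R'. insert z R' \<in> fam (\<phi> id)}"
      let ?z = "inv u y"
      have uz: "u ?z = y" using up by (simp add: permutes_inverses)
      have "?z \<in> V" using y up by (simp add: permutes_in_image permutes_inv)
      moreover have "?z \<notin> R" using y u(2) uz by (metis DiffD2 image_eqI mem_Collect_eq)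
      moreover have "insert ?z R \<in> fam (\<phi> id)"
        using fam_stab[OF u(1), of "insert ?z R"] y uz u(2) by simp
      ultimately show "y \<in> u ` {z \<in> V - R. insert z R \<in> fam (\<phi> id)}"
        using uz by (intro image_eqI[of _ _ ?z]) auto
    next
      fix y assume "y \<in> u ` {z \<in> V - R. insert z R \<in> fam (\<phi> id)}"
      then obtain z where z: "y = u z" "z \<in> V" "z \<notin> R" "insert z R \<in> fam (\<phi> id)" by blast
      then show "y \<in> {z \<in> V - R'. insert z R' \<in> fam (\<phi> id)}"
        using fam_stab[OF u(1), of "insert z R"] u(2) permutes_in_image[OF up]
          inj_image_mem_iff[OF permutes_inj[OF up]] by auto
    qed
    show ?thesis
      unfolding deg_def img[symmetric] using card_image[OF permutes_inj_on[OF up]] by (rule sym)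
  qed
  obtain R0 where R0: "R0 \<in> subsets_of_card V j"
    using subsets_of_card_Suc_cases[OF S(1)] by blast
  \<comment> \<open>The average of the indicator over the \<open>card V - j\<close> one-point
    extensions of a \<open>j\<close>-set.\<close>
  define \<mu> where "\<mu> = real (deg R0) / real (card V - j)"
  define c where "c = (\<lambda>i T. of_bool (T \<in> fam i) - \<mu>)"
  have harm: "harmonic V (Suc j) (c (\<phi> id))"
    unfolding harmonic_def
  proof (intro allI impI)
    fix R assume "R \<subseteq> V \<and> Suc (card R) = Suc j"
    then have R: "R \<in> subsets_of_card V j" "card R = j" "finite R" "R \<subseteq> V"
      using finite_V by (auto simp: subsets_of_card_def dest: finite_subset)
    have "(\<Sum>z\<in>V - R. c (\<phi> id) (insert z R)) =
        (\<Sum>z\<in>V - R. of_bool (insert z R \<in> fam (\<phi> id))) - real (card (V - R)) * \<mu>"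
      by (simp add: c_def sum_subtractf)
    also have "(\<Sum>z\<in>V - R. of_bool (insert z R \<in> fam (\<phi> id))) = real (deg R)"
      unfolding deg_def using finite_V by (simp add: Int_def)
    also have "deg R = deg R0" using deg_eq R R0 by blast
    also have "card (V - R) = card V - j" using R by (simp add: card_Diff_subset)
    also have "real (deg R0) - real (card V - j) * \<mu> = 0"
      using le by (simp add: \<mu>_def)
    finally show "(\<Sum>z\<in>V - R. c (\<phi> id) (insert z R)) = 0" .
  qed
  have closed: "\<exists>i'\<in>orbit. \<forall>T\<in>subsets_of_card V (Suc j). c i (\<pi> ` T) = c i' T"
    if i: "i \<in> orbit" and \<pi>: "\<pi> permutes V" for i \<pi>
  proof -
    obtain \<sigma> where \<sigma>: "i = \<phi> \<sigma>" "\<sigma> permutes V" using i by (auto simp: orbit_def)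
    let ?\<rho> = "inv \<pi> \<circ> \<sigma>"
    have \<rho>: "?\<rho> permutes V" using \<pi> \<sigma> by (simp add: permutes_compose permutes_inv)
    have inv: "\<pi> \<circ> ?\<rho> = \<sigma>" by (simp add: o_assoc permutes_inv_o(1)[OF \<pi>])
    have "\<pi> ` T \<in> fam i \<longleftrightarrow> T \<in> fam (\<phi> ?\<rho>)" for T
    proof
      assume "\<pi> ` T \<in> fam i"
      then have "inv \<pi> ` \<pi> ` T \<in> fam (\<phi> ?\<rho>)"
        using fam_translate[OF permutes_inv[OF \<pi>] \<sigma>(2)] \<sigma>(1) by blast
      then show "T \<in> fam (\<phi> ?\<rho>)" by (simp add: image_image permutes_inverses(2)[OF \<pi>])
    next
      assume "T \<in> fam (\<phi> ?\<rho>)"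
      from fam_translate[OF \<pi> \<rho> this] show "\<pi> ` T \<in> fam i" by (simp only: inv \<sigma>(1))
    qed
    moreover have "\<phi> ?\<rho> \<in> orbit" using \<rho> by (simp add: orbit_def)
    ultimately show ?thesis by (auto simp: c_def)
  qed
  have "S0 = id ` S0" by simp
  then have "S0 \<in> fam (\<phi> id)" "S1 \<notin> fam (\<phi> id)"
    using S(3) id_in_stabilizer unfolding fam_id by blast+
  then have "c (\<phi> id) S0 \<noteq> 0 \<or> c (\<phi> id) S1 \<noteq> 0" by (simp add: c_def)
  moreover have "\<phi> id \<in> orbit" by (auto simp: orbit_def permutes_id)
  ultimately show ?thesis
    using binomial_le_card_of_harmonic_family[OF finite_V le finite_orbit closed _ harm] S(1,2)
    by blast
qed

text \<open>All sets of size \<open>t\<close> are images of \<open>T\<close>. Permutations with the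
  same \<open>\<phi>\<close> differ by a stabilizer element, which preserves \<open>T\<close>, so
  distinct images need distinct orbit elements.\<close>

lemma card_orbit_ge_of_invariant_set:
  assumes "T \<in> subsets_of_card V t" "\<And>u. u \<in> stabilizer \<Longrightarrow> u ` T = T"
  shows "card V choose t \<le> card orbit"
proof -
  have "\<exists>\<pi>. \<pi> permutes V \<and> \<pi> ` T = T'" if "T' \<in> subsets_of_card V t" for T'
    using permutes_with_image[OF finite_V assms(1) that] by blast
  then obtain r where r: "\<And>T'. T' \<in> subsets_of_card V t \<Longrightarrow> r T' permutes V \<and> r T' ` T = T'"
    by metis
  have "inj_on (\<phi> \<circ> r) (subsets_of_card V t)"
  proof
    fix A B assume AB: "A \<in> subsets_of_card V t" "B \<in> subsets_of_card V t" "(\<phi> \<circ> r) A = (\<phi> \<circ> r) B"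
    then have "inv (r A) \<circ> r B \<in> stabilizer"
      using r by (intro translate_eq_imp_stabilizer) auto
    then have "inv (r A) ` B = T" using assms(2) r[OF AB(2)] by (metis image_comp)
    then have "r A ` T = B"
      using r[OF AB(1)] by (auto simp: image_image permutes_inverses)
    with r[OF AB(1)] show "A = B" by simp
  qed
  moreover have "(\<phi> \<circ> r) ` subsets_of_card V t \<subseteq> orbit"
    using r by (auto simp: orbit_def)
  ultimately have "card (subsets_of_card V t) \<le> card orbit"
    using finite_orbit by (rule card_inj_on_le)
  then show ?thesis using finite_V by simp
qed

text \<open>Restricts the action to the permutations that fix \<open>V - W\<close>
  pointwise.\<close>

lemma orbit_map_subset: "W \<subseteq> V \<Longrightarrow> orbit_map W \<phi>"
  using finite_V translate_cong permutes_subset[of _ W V]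
  by (intro orbit_map.intro) (auto intro: finite_subset)

text \<open>As the stabilizer fixes \<open>v\<close>, an orbit element determines where
  \<open>v\<close> is sent. Each of the \<open>card V\<close> images \<open>w\<close> contributes a
  copy of the suborbit for \<open>V - {v}\<close>, moved there by \<open>swap v w\<close>.\<close>

lemma card_orbit_ge_of_fixed_point:
  assumes v: "v \<in> V" "\<And>u. u \<in> stabilizer \<Longrightarrow> u v = v"
  shows "card V * card (orbit_map.orbit (V - {v}) \<phi>) \<le> card orbit"
proof -
  interpret sub: orbit_map "V - {v}" \<phi> by (rule orbit_map_subset[OF Diff_subset])
  obtain r where r: "\<And>i. i \<in> sub.orbit \<Longrightarrow> r i permutes V - {v} \<and> \<phi> (r i) = i"
  proof -
    have "\<exists>\<pi>. \<pi> permutes V - {v} \<and> \<phi> \<pi> = i" if "i \<in> sub.orbit" for i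
      using that by (auto simp: sub.orbit_def)
    then show thesis using that by metis
  qed
  have rV: "r i permutes V" "r i v = v" if "i \<in> sub.orbit" for i
    using r[OF that] permutes_subset[of "r i" "V - {v}" V] permutes_not_in[of "r i" "V - {v}" v]
    by auto
  let ?f = "\<lambda>(w, i). \<phi> (swap v w \<circ> r i)"
  have perm: "swap v w \<circ> r i permutes V" if "w \<in> V" "i \<in> sub.orbit" for w i
    using rV that v by (intro permutes_compose permutes_swap_id)
  have "inj_on ?f (V \<times> sub.orbit)"
  proof (rule inj_onI, clarify)
    fix w i w' i'
    assume asm: "w \<in> V" "i \<in> sub.orbit" "w' \<in> V" "i' \<in> sub.orbit"
      and eq: "\<phi> (swap v w \<circ> r i) = \<phi> (swap v w' \<circ> r i')"
    let ?p = "swap v w \<circ> r i" and ?q = "swap v w' \<circ> r i'"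
    have p: "?p permutes V" "?q permutes V" using perm asm by blast+
    have "(inv ?p \<circ> ?q) v = v"
      using v(2) translate_eq_imp_stabilizer[OF p eq] by blast
    then have "?q v = ?p v" using permutes_inverses(1)[OF p(1)] by (metis comp_apply)
    then have w: "w = w'" using rV asm by simp
    have "\<phi> (swap v w \<circ> ?p) = \<phi> (swap v w \<circ> ?q)"
      using translate_cong[OF _ p eq] permutes_swap_id v(1) asm(1) by metis
    then have "\<phi> (r i) = \<phi> (r i')" by (simp add: w o_assoc)
    with r asm w show "w = w' \<and> i = i'" by metis
  qed
  moreover have "?f ` (V \<times> sub.orbit) \<subseteq> orbit"
    using perm by (auto simp: orbit_def)
  ultimately have "card (V \<times> sub.orbit) \<le> card orbit"
    using finite_orbit by (rule card_inj_on_le)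
  then show ?thesis by (simp add: card_cartesian_product)
qed

end

section \<open>Estimates for binomial coefficients\<close>

lemma binomial_Suc_mult: "(n choose Suc j) * Suc j = (n choose j) * (n - j)"
  using binomial_absorb_comp[of n j] binomial_absorption[of j n] by (simp only: mult.commute)

text \<open>Equality holds at \<open>j = 1\<close>. From \<open>k\<close> to \<open>Suc k\<close>
  the right side grows by the factor \<open>(n - k) / (k + 1)\<close>, the left only by
  \<open>(k + 2) / (k + 1)\<close>.\<close>

lemma binomial_ge_half_mult:
  assumes "2 * Suc j \<le> n" "1 \<le> j"
  shows "n * Suc j \<le> 2 * (n choose j)"
  using assms(2,1)
proof (induction j rule: dec_induct)
  case base
  then show ?case by simp
next
  case (step k)
  have "n * Suc (Suc k) * Suc k \<le> 2 * (n choose k) * Suc (Suc k)"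
    using mult_right_mono[OF step.IH, of "Suc (Suc k)"] step by (simp add: algebra_simps)
  also have "\<dots> \<le> 2 * (n choose k) * (n - k)" using step by (intro mult_left_mono) auto
  also have "\<dots> = 2 * (n choose Suc k) * Suc k"
    by (simp only: mult.assoc binomial_Suc_mult)
  finally show ?case by (simp only: mult_le_cancel2)
qed

text \<open>With \<open>n = 2 * j + 1 + m\<close>, the two coefficients differ by
  \<open>(n choose j) * m / (j + 1)\<close>, which is at least \<open>n * m / 2\<close>. In
  \<open>orbit_bound\<close>, \<open>m\<close> counts the indices from \<open>j + 1\<close> to
  \<open>n - j - 1\<close>.\<close>

lemma binomial_difference_ge:
  assumes "2 * Suc j \<le> n" "1 \<le> j"
  shows "n * (n - 2 * j - 1) + 2 * (n choose j) \<le> 2 * (n choose Suc j)"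
proof -
  obtain m where m: "n = 2 * j + 1 + m" using assms(1) le_iff_add[of "2 * j + 1" n] by auto
  have "(n * m + 2 * (n choose j)) * Suc j \<le> 2 * (n choose j) * m + 2 * (n choose j) * Suc j"
    using mult_right_mono[OF binomial_ge_half_mult[OF assms], of m] by (simp add: algebra_simps)
  also have "\<dots> = 2 * ((n choose j) * (n - j))" using m by (simp add: algebra_simps)
  also have "(n choose j) * (n - j) = (n choose Suc j) * Suc j"
    by (simp only: binomial_Suc_mult)
  finally have "n * m + 2 * (n choose j) \<le> 2 * (n choose Suc j)"
    by (simp only: mult.assoc[symmetric] mult_le_cancel2)
  then show ?thesis using m by simp
qed

section \<open>Functions on labelings and the facets they separate\<close>

definition labelings :: "('v::finite \<Rightarrow> nat) set" where
  "labelings = {x. bij_betw x UNIV {1..CARD('v)}}"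

lemma labelings_comp:
  assumes "x \<in> labelings" "\<pi> permutes UNIV"
  shows "x \<circ> \<pi> \<in> labelings"
  using assms permutes_imp_bij[OF assms(2)] by (auto simp: labelings_def intro: bij_betw_trans)

lemma labelings_range:
  fixes x :: "'v::finite \<Rightarrow> nat"
  shows "x \<in> labelings \<Longrightarrow> x v \<in> {1..CARD('v)}"
  by (auto simp: labelings_def bij_betw_def)

lemma labelings_inj: "x \<in> labelings \<Longrightarrow> inj x"
  by (auto simp: labelings_def bij_betw_def)

lemma labelings_vimage:
  fixes x :: "'v::finite \<Rightarrow> nat"
  assumes "x \<in> labelings" "j \<le> CARD('v)"
  shows "x ` (x -` {1..j}) = {1..j}" "card (x -` {1..j}) = j"
proof -
  have "range x = {1..CARD('v)}" using assms(1) by (simp add: labelings_def bij_betw_def)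
  with assms(2) show img: "x ` (x -` {1..j}) = {1..j}"
    by (auto simp: image_vimage_eq)
  have "card (x ` (x -` {1..j})) = card (x -` {1..j})"
    using labelings_inj[OF assms(1)] by (intro card_image) (auto intro: inj_on_subset)
  then show "card (x -` {1..j}) = j" unfolding img by simp
qed

text \<open>A left action, see \<open>translate_translate\<close>. By the restriction, translates
  are equal as soon as they agree on labelings, so values elsewhere affect neither orbits nor
  stabilizers.\<close>

definition translate :: "(('v::finite \<Rightarrow> nat) \<Rightarrow> real) \<Rightarrow> ('v \<Rightarrow> 'v) \<Rightarrow> ('v \<Rightarrow> nat) \<Rightarrow> real" where
  "translate g \<pi> = restrict (\<lambda>x. g (x \<circ> \<pi>)) labelings"

lemma translate_translate:
  assumes "\<sigma> permutes UNIV"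
  shows "translate (translate g \<pi>) \<sigma> = translate g (\<sigma> \<circ> \<pi>)"
  using labelings_comp[OF _ assms] by (auto simp: translate_def restrict_def comp_assoc)

lemma translate_id: "g \<in> extensional labelings \<Longrightarrow> translate g id = g"
  by (simp add: translate_def extensional_restrict)

lemma orbit_map_translate: "orbit_map UNIV (translate g)"
proof
  fix \<sigma> \<pi> \<pi>' :: "'a \<Rightarrow> 'a"
  assume "\<sigma> permutes UNIV" "translate g \<pi> = translate g \<pi>'"
  then show "translate g (\<sigma> \<circ> \<pi>) = translate g (\<sigma> \<circ> \<pi>')"
    by (simp add: translate_translate[symmetric])
qed simp

abbreviation stabilizer :: "(('v::finite \<Rightarrow> nat) \<Rightarrow> real) \<Rightarrow> ('v \<Rightarrow> 'v) set" where
  "stabilizer g \<equiv> orbit_map.stabilizer UNIV (translate g)"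

abbreviation orbit :: "(('v::finite \<Rightarrow> nat) \<Rightarrow> real) \<Rightarrow> (('v \<Rightarrow> nat) \<Rightarrow> real) set" where
  "orbit g \<equiv> orbit_map.orbit UNIV (translate g)"

lemma stabilizer_invariant:
  assumes "u \<in> stabilizer g" "x \<in> labelings"
  shows "g (x \<circ> u) = g x"
proof -
  interpret orbit_map UNIV "translate g" by (rule orbit_map_translate)
  have "translate g u x = translate g id x" using assms(1) by (simp add: stabilizer_def)
  with assms(2) show ?thesis by (simp add: translate_def)
qed

text \<open>The labelings \<open>y\<close> with \<open>y ` S = {1..j}\<close> are the vertices of a facet of the permutahedron, and
  \<open>x\<close> is a vertex off that facet for which the facet inequality has slack one.\<close>

definition separates :: "(('v::finite \<Rightarrow> nat) \<Rightarrow> real) \<Rightarrow> nat \<Rightarrow> 'v set \<Rightarrow> ('v \<Rightarrow> nat) \<Rightarrow> bool" where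
  "separates g j S x \<longleftrightarrow> card S = j \<and> (\<forall>y\<in>labelings. y ` S = {1..j} \<longrightarrow> g y = 0) \<and>
     x \<in> labelings \<and> x ` S = insert (Suc j) {1..<j} \<and> g x \<noteq> 0"

definition separated :: "(('v::finite \<Rightarrow> nat) \<Rightarrow> real) \<Rightarrow> nat set" where
  "separated g = {j \<in> {1..<CARD('v)}. \<exists>S x. separates g j S x}"

lemma separates_vanishes:
  assumes "separates g j S x" "u \<in> stabilizer g" "y \<in> labelings" "y ` u ` S = {1..j}"
  shows "g y = 0"
proof -
  interpret orbit_map UNIV "translate g" by (rule orbit_map_translate)
  have "y \<circ> u \<in> labelings" using assms(2,3) by (simp add: labelings_comp stabilizer_def)
  moreover have "(y \<circ> u) ` S = {1..j}" using assms(4) by (simp add: image_comp)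
  ultimately have "g (y \<circ> u) = 0" using assms(1) by (simp add: separates_def)
  then show ?thesis using stabilizer_invariant[OF assms(2,3)] by simp
qed

text \<open>The vertex \<open>x\<close> lies on the facet of the set of points with labels at most
  \<open>j\<close>. If a stabilizer element mapped \<open>S\<close> onto that set, \<open>g\<close>
  would vanish at \<open>x\<close>.\<close>

lemma separates_not_in_orbit:
  fixes g :: "('v::finite \<Rightarrow> nat) \<Rightarrow> real"
  assumes "separates g j S x" "j < CARD('v)" "u \<in> stabilizer g"
  shows "u ` S \<noteq> x -` {1..j}"
proof
  assume "u ` S = x -` {1..j}"
  then have "x ` u ` S = {1..j}"
    using labelings_vimage(1)[of x j] assms by (simp add: separates_def)
  then have "g x = 0" using separates_vanishes[OF assms(1,3)] assms(1) by (simp add: separates_def)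
  with assms(1) show False by (simp add: separates_def)
qed

lemma separated_not_homogeneous:
  fixes g :: "('v::finite \<Rightarrow> nat) \<Rightarrow> real"
  assumes "j \<in> separated g"
  shows "\<not> orbit_map.homogeneous UNIV (translate g) j"
proof -
  interpret orbit_map UNIV "translate g" by (rule orbit_map_translate)
  obtain S x where S: "separates g j S x" "j < CARD('v)"
    using assms by (auto simp: separated_def)
  then have "S \<in> subsets_of_card UNIV j" "x -` {1..j} \<in> subsets_of_card UNIV j"
    using labelings_vimage(2)[of x j] by (auto simp: separates_def subsets_of_card_def)
  with separates_not_in_orbit[OF S] show ?thesis unfolding homogeneous_def by blast
qed

text \<open>Ensures that the whole orbit of \<open>g\<close> contributes no index beyond those of
  \<open>g\<close> itself.\<close>

lemma separated_translate:
  assumes "\<pi> permutes UNIV"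
  shows "separated (translate g \<pi>) \<subseteq> separated g"
proof
  fix j assume "j \<in> separated (translate g \<pi>)"
  then obtain S x where j: "j \<in> {1..<CARD('a)}" and S: "separates (translate g \<pi>) j S x"
    by (auto simp: separated_def)
  have inv: "\<pi> ` inv \<pi> ` S = S" by (simp add: image_image permutes_inverses(1)[OF assms])
  have "separates g j (inv \<pi> ` S) (x \<circ> \<pi>)"
    unfolding separates_def
  proof (intro conjI ballI impI)
    show "card (inv \<pi> ` S) = j"
      using S permutes_inv[OF assms] by (simp add: separates_def card_image permutes_inj_on)
    show "x \<circ> \<pi> \<in> labelings" using S assms by (simp add: separates_def labelings_comp)
    show "(x \<circ> \<pi>) ` inv \<pi> ` S = insert (Suc j) {1..<j}"
      using S unfolding image_comp[symmetric] inv by (simp add: separates_def)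
    show "g (x \<circ> \<pi>) \<noteq> 0" using S by (auto simp: separates_def translate_def)
  next
    fix y :: "'a \<Rightarrow> nat" assume y: "y \<in> labelings" "y ` inv \<pi> ` S = {1..j}"
    then have "y \<circ> inv \<pi> \<in> labelings" using assms by (simp add: labelings_comp permutes_inv)
    moreover have "(y \<circ> inv \<pi>) ` S = {1..j}" using y(2) by (simp add: image_comp)
    ultimately have "translate g \<pi> (y \<circ> inv \<pi>) = 0" using S by (simp add: separates_def)
    then show "g y = 0"
      using \<open>y \<circ> inv \<pi> \<in> labelings\<close>
      by (simp add: translate_def comp_assoc permutes_inv_o(2)[OF assms])
  qed
  with j show "j \<in> separated g" by (auto simp: separated_def)
qed

text \<open>The stabilizer is transitive on the sets of given size containing \<open>v\<close>, and
  on those avoiding \<open>v\<close>. So if \<open>S\<close> and \<open>x\<close> separate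
  \<open>j\<close>, then \<open>g\<close> vanishes at every \<open>y\<close> for which
  \<open>v \<in> S\<close> holds exactly when \<open>y v \<le> j\<close>. The cases
  \<open>v \<in> S\<close> and \<open>v \<notin> S\<close> force \<open>Min Y = j + 1\<close> and
  \<open>Max Y = j\<close>.\<close>

lemma card_separated_le_2:
  fixes g :: "('v::finite \<Rightarrow> nat) \<Rightarrow> real"
  assumes fix_v: "\<And>u. u \<in> stabilizer g \<Longrightarrow> u v = v"
    and hom: "\<And>i. orbit_map.homogeneous (UNIV - {v}) (translate g) i"
  shows "card (separated g) \<le> 2"
proof -
  interpret orbit_map UNIV "translate g" by (rule orbit_map_translate)
  interpret sub: orbit_map "UNIV - {v}" "translate g" by (rule orbit_map_subset[OF Diff_subset])
  have trans: "\<exists>u\<in>stabilizer. u ` S = S'" if S: "card S = card S'" "v \<in> S \<longleftrightarrow> v \<in> S'" for S S'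
  proof -
    have "card (S - {v}) = card (S' - {v})" using S by (cases "v \<in> S") auto
    then have "S - {v} \<in> subsets_of_card (UNIV - {v}) (card (S - {v}))"
      "S' - {v} \<in> subsets_of_card (UNIV - {v}) (card (S - {v}))"
      by (auto simp: subsets_of_card_def)
    then obtain u where u: "u \<in> sub.stabilizer" "u ` (S - {v}) = S' - {v}"
      using hom unfolding sub.homogeneous_def by blast
    have "u \<in> stabilizer"
      using u(1) permutes_subset[of u "UNIV - {v}" UNIV] by (auto simp: stabilizer_def sub.stabilizer_def)
    moreover from this have "u ` S = S'"
    proof (cases "v \<in> S")
      case True
      then have "u ` S = insert (u v) (u ` (S - {v}))" by blast
      with True u(2) S(2) fix_v[OF \<open>u \<in> stabilizer\<close>] show ?thesis by auto
    qed (use u(2) S(2) in simp)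
    ultimately show ?thesis by blast
  qed
  define Y where "Y = {y v |y. y \<in> labelings \<and> g y \<noteq> 0}"
  have finY: "finite Y"
  proof (rule finite_subset)
    show "Y \<subseteq> {1..CARD('v)}" unfolding Y_def using labelings_range by blast
  qed simp
  have "separated g \<subseteq> {Min Y - 1, Max Y}"
  proof
    fix j assume "j \<in> separated g"
    then obtain S x where S: "separates g j S x" and j: "1 \<le> j" "j < CARD('v)"
      by (auto simp: separated_def)
    then have x: "x \<in> labelings" "card S = j" "x ` S = insert (Suc j) {1..<j}" "g x \<noteq> 0"
      by (auto simp: separates_def)
    then have xY: "x v \<in> Y" by (auto simp: Y_def)
    have vanish: "g y = 0" if y: "y \<in> labelings" "v \<in> S \<longleftrightarrow> v \<in> y -` {1..j}" for y
    proof -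
      have card: "card S = card (y -` {1..j})"
        using labelings_vimage(2)[OF y(1)] j x(2) by simp
      obtain u where "u \<in> stabilizer" "u ` S = y -` {1..j}"
        using trans[OF card y(2)] by blast
      then show ?thesis
        using separates_vanishes[OF S, of u y] labelings_vimage(1)[OF y(1)] j y(1) by simp
    qed
    \<comment> \<open>As \<open>g x\<close> is nonzero, \<open>vanish\<close> cannot apply to
      \<open>x\<close>. This leaves \<open>j + 1\<close> as the only label for \<open>v\<close>
      inside \<open>S\<close>, and \<open>j\<close> as the only one outside.\<close>
    with x have v: "v \<in> S \<longleftrightarrow> \<not> x v \<in> {1..j}" by auto
    have mem: "x v \<in> x ` S \<longleftrightarrow> v \<in> S"
      using inj_image_mem_iff[OF labelings_inj[OF x(1)]] .
    have ge1: "1 \<le> y v" if "y \<in> labelings" for y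
      using labelings_range[OF that, of v] by simp
    show "j \<in> {Min Y - 1, Max Y}"
    proof (cases "v \<in> S")
      case True
      then have "x v = Suc j" using mem v x(3) ge1[OF x(1)] by auto
      moreover have "Suc j \<le> y" if "y \<in> Y" for y
        using that vanish True ge1 unfolding Y_def by (auto simp: not_less_eq_eq[symmetric])
      ultimately have "Min Y = Suc j" using xY finY by (intro Min_eqI) auto
      then show ?thesis by simp
    next
      case False
      then have "x v = j" using mem v x(3) ge1[OF x(1)] by auto
      moreover have "y \<le> j" if "y \<in> Y" for y
        using that vanish False unfolding Y_def by auto
      ultimately have "Max Y = j" using xY finY by (intro Max_eqI) auto
      then show ?thesis by simp
    qed
  qed
  then have "card (separated g) \<le> card {Min Y - 1, Max Y}" by (intro card_mono) auto
  also have "\<dots> \<le> 2" by (simp add: card_insert_if)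
  finally show ?thesis .
qed

section \<open>Orbit size against the number of separated indices\<close>

text \<open>If all sizes are homogeneous off \<open>v\<close>, at most two indices are separated,
  and the orbit has at least \<open>CARD('v)\<close> elements. Otherwise the suborbit has at least
  \<open>(CARD('v) - 1) / 2\<close> elements, and the orbit is at least \<open>CARD('v)\<close>
  times as large.\<close>

lemma orbit_bound_fixed_point:
  fixes g :: "('v::finite \<Rightarrow> nat) \<Rightarrow> real"
  assumes n: "3 \<le> CARD('v)" and fix_v: "\<And>u. u \<in> stabilizer g \<Longrightarrow> u v = v"
  shows "CARD('v) * card (separated g) \<le> 2 * card (orbit g) \<or>
    CARD('v) * (CARD('v) - 1) \<le> 2 * card (orbit g)"
proof -
  interpret orbit_map UNIV "translate g" by (rule orbit_map_translate)
  interpret sub: orbit_map "UNIV - {v}" "translate g" by (rule orbit_map_subset[OF Diff_subset])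
  let ?m = "card (UNIV - {v})"
  have m: "?m = CARD('v) - 1" by (simp add: card_Diff_subset)
  show ?thesis
  proof (cases "\<forall>i. sub.homogeneous i")
    case True
    have "CARD('v) choose 1 \<le> card orbit"
      by (rule card_orbit_ge_of_invariant_set[of "{v}"]) (use fix_v in \<open>auto simp: subsets_of_card_def\<close>)
    moreover have "CARD('v) * card (separated g) \<le> CARD('v) * 2"
      using card_separated_le_2[of g v] fix_v True by (intro mult_left_mono) auto
    ultimately show ?thesis by (simp only: choose_one) linarith
  next
    case False
    then obtain j where j: "sub.homogeneous j" "\<not> sub.homogeneous (Suc j)" "2 * Suc j \<le> ?m"
      using sub.first_inhomogeneous by metis
    have dim: "?m choose Suc j \<le> (?m choose j) + card sub.orbit"
      using sub.card_orbit_ge_of_inhomogeneous j by blast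
    have "?m \<le> 2 * card sub.orbit"
    proof (cases "j = 0")
      case True
      \<comment> \<open>The suborbit has at least \<open>CARD('v) - 2\<close> elements here, enough
        because \<open>CARD('v)\<close> is at least three.\<close>
      with dim have "?m \<le> 1 + card sub.orbit" by simp
      with n m show ?thesis by simp
    next
      case False
      have "?m * 1 \<le> ?m * (?m - 2 * j - 1)" using j(3) by (intro mult_left_mono) auto
      moreover have "1 \<le> j" using False by simp
      ultimately show ?thesis using binomial_difference_ge[OF j(3)] dim by linarith
    qed
    then have "CARD('v) * (CARD('v) - 1) \<le> 2 * (CARD('v) * card sub.orbit)"
      unfolding m by (metis mult.left_commute mult_le_mono2)
    also have "\<dots> \<le> 2 * card orbit"
      using card_orbit_ge_of_fixed_point[of v] fix_v by simp
    finally show ?thesis by simp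
  qed
qed

lemma choose_2_le:
  fixes n t :: nat
  assumes "2 \<le> t" "t + 2 \<le> n"
  shows "n choose 2 \<le> n choose t"
proof (cases "2 * t \<le> n")
  case True
  then show ?thesis using assms by (intro binomial_mono) auto
next
  case False
  then have "n choose 2 \<le> n choose (n - t)" using assms by (intro binomial_mono) auto
  then show ?thesis using binomial_symmetric[of t n] assms by simp
qed

text \<open>Let \<open>Suc j\<close> be the first inhomogeneous size. For positive \<open>j\<close>
  the dimension bound outweighs the number of indices in the inhomogeneous range. For
  \<open>j = 0\<close> the stabilizer is intransitive on points, and its orbits yield a large family
  of images or a fixed point.\<close>

lemma orbit_bound:
  fixes g :: "('v::finite \<Rightarrow> nat) \<Rightarrow> real"
  assumes n: "3 \<le> CARD('v)"
  shows "CARD('v) * card (separated g) \<le> 2 * card (orbit g) \<or>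
    CARD('v) * (CARD('v) - 1) \<le> 2 * card (orbit g)"
proof -
  interpret orbit_map UNIV "translate g" by (rule orbit_map_translate)
  show ?thesis
  proof (cases "separated g = {}")
    case False
    then obtain i where "\<not> homogeneous i" using separated_not_homogeneous by blast
    then obtain j where j: "homogeneous j" "\<not> homogeneous (Suc j)" "2 * Suc j \<le> CARD('v)"
      and range: "\<And>k. \<not> homogeneous k \<Longrightarrow> Suc j \<le> k \<and> k + Suc j \<le> CARD('v)"
      using first_inhomogeneous by metis
    show ?thesis
    proof (cases "j = 0")
      case False
      have "separated g \<subseteq> {Suc j..CARD('v) - Suc j}"
        using range separated_not_homogeneous by fastforce
      then have "card (separated g) \<le> card {Suc j..CARD('v) - Suc j}"
        by (intro card_mono) auto
      also have "\<dots> = CARD('v) - 2 * j - 1" using j(3) by simp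
      finally have "CARD('v) * card (separated g) \<le> CARD('v) * (CARD('v) - 2 * j - 1)"
        by (rule mult_left_mono) simp
      moreover have "1 \<le> j" using False by simp
      ultimately show ?thesis
        using binomial_difference_ge[OF j(3)] card_orbit_ge_of_inhomogeneous[OF j] by linarith
    next
      case True
      with j(2) obtain a b where ab: "\<forall>u\<in>stabilizer. u a \<noteq> b"
        by (auto simp: homogeneous_def subsets_of_card_def card_1_singleton_iff)
      \<comment> \<open>This stabilizer orbit contains \<open>a\<close> but not \<open>b\<close>, so
        \<open>T\<close> and its complement are nonempty and invariant; if either is a singleton, it
        gives a fixed point.\<close>
      define T where "T = {u a |u. u \<in> stabilizer}"
      have uT: "u t \<in> T" if "u \<in> stabilizer" "t \<in> T" for u t
        using that stabilizer_comp unfolding T_def by (force simp: comp_def)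
      have inT: "t \<in> T" if u: "u \<in> stabilizer" and t: "u t \<in> T" for u t
        using uT[OF stabilizer_inv[OF u] t] permutes_inverses(2)[OF stabilizer_permutes[OF u]] by simp
      have aT: "a \<in> T" using id_in_stabilizer unfolding T_def by (metis (mono_tags) id_apply mem_Collect_eq)
      have bT: "b \<notin> T" using ab by (auto simp: T_def)
      have cases: "(2 \<le> card T \<and> card T + 2 \<le> CARD('v)) \<or> card T = 1 \<or> card (UNIV - T) = 1"
      proof -
        have "card T \<noteq> 0" using aT by auto
        moreover have "card (UNIV - T) \<noteq> 0" using bT by auto
        moreover have "card (UNIV - T) = CARD('v) - card T" by (simp add: card_Diff_subset)
        ultimately show ?thesis by linarith
      qed
      have "u ` T = T" if u: "u \<in> stabilizer" for u
        using uT[OF u] stabilizer_permutes[OF u]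
        by (intro card_subset_eq) (auto simp: card_image permutes_inj_on)
      then have large: "CARD('v) choose card T \<le> card orbit"
        by (intro card_orbit_ge_of_invariant_set[of T]) (auto simp: subsets_of_card_def)
      show ?thesis
      proof (cases "2 \<le> card T \<and> card T + 2 \<le> CARD('v)")
        case True
        then have "CARD('v) choose 2 \<le> card orbit"
          using choose_2_le[of "card T" "CARD('v)"] large by linarith
        moreover have "(CARD('v) choose 2) * 2 = CARD('v) * (CARD('v) - 1)"
          using binomial_Suc_mult[of "CARD('v)" 1] by (simp add: numeral_2_eq_2)
        ultimately show ?thesis by linarith
      next
        case False
        with cases have "\<exists>v. \<forall>u\<in>stabilizer. u v = v"
        proof (elim disjE)
          assume "card T = 1"
          then obtain v where "T = {v}" by (auto simp: card_1_singleton_iff)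
          then show ?thesis using uT by blast
        next
          assume "card (UNIV - T) = 1"
          then obtain v where v: "UNIV - T = {v}" by (auto simp: card_1_singleton_iff)
          then have "u v = v" if "u \<in> stabilizer" for u using inT[OF that, of v] by blast
          then show ?thesis by blast
        qed auto
        then show ?thesis using orbit_bound_fixed_point[OF n] by blast
      qed
    qed
  qed simp
qed

text \<open>One orbit is removed at a time. The inequalities of the first kind add up over the
  orbits; one of the second kind for a single orbit passes to the larger \<open>F\<close>.\<close>

lemma separated_bound:
  fixes F :: "(('v::finite \<Rightarrow> nat) \<Rightarrow> real) set"
  assumes "finite F" "3 \<le> CARD('v)" "F \<subseteq> extensional labelings"
    and "\<And>g \<pi>. g \<in> F \<Longrightarrow> \<pi> permutes UNIV \<Longrightarrow> translate g \<pi> \<in> F"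
  shows "CARD('v) * card (\<Union>(separated ` F)) \<le> 2 * card F \<or> CARD('v) * (CARD('v) - 1) \<le> 2 * card F"
  using assms
proof (induction F rule: finite_psubset_induct)
  case (psubset F)
  show ?case
  proof (cases "F = {}")
    case False
    then obtain g where g: "g \<in> F" by blast
    interpret orbit_map UNIV "translate g" by (rule orbit_map_translate)
    let ?G = "F - orbit"
    have sub: "orbit \<subseteq> F" using psubset.prems(3) g by (auto simp: orbit_def)
    have "g \<in> orbit"
      unfolding orbit_def
    proof
      show "g = translate g id"
        using translate_id[OF subsetD[OF psubset.prems(2) g]] by (rule sym)
    qed (simp add: permutes_id)
    then have "?G \<subset> F" using g by blast
    moreover have "translate h \<pi> \<in> ?G" if h: "h \<in> ?G" and \<pi>: "\<pi> permutes UNIV" for h \<pi>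
    proof
      show "translate h \<pi> \<in> F" using psubset.prems(3) h \<pi> by blast
      show "translate h \<pi> \<notin> orbit"
      proof
        assume "translate h \<pi> \<in> orbit"
        then obtain \<sigma> where \<sigma>: "\<sigma> permutes UNIV" "translate h \<pi> = translate g \<sigma>"
          by (auto simp: orbit_def)
        have "h = translate (translate h \<pi>) (inv \<pi>)"
          using h psubset.prems(2) translate_id[of h]
          by (auto simp: translate_translate[OF permutes_inv[OF \<pi>]] permutes_inv_o(2)[OF \<pi>])
        also have "\<dots> = translate g (inv \<pi> \<circ> \<sigma>)"
          by (simp add: \<sigma>(2) translate_translate[OF permutes_inv[OF \<pi>]])
        also have "\<dots> \<in> orbit"
          using permutes_compose[OF \<sigma>(1) permutes_inv[OF \<pi>]] by (simp add: orbit_def)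
        finally show False using h by blast
      qed
    qed
    ultimately have IH: "CARD('v) * card (\<Union>(separated ` ?G)) \<le> 2 * card ?G \<or>
        CARD('v) * (CARD('v) - 1) \<le> 2 * card ?G"
      using psubset.IH[of ?G] psubset.prems by blast
    have card_F: "card F = card orbit + card ?G"
      using sub psubset.hyps finite_orbit by (simp add: card_Diff_subset card_mono)
    have "separated h \<subseteq> separated g" if "h \<in> orbit" for h
      using that separated_translate unfolding orbit_def by blast
    then have "\<Union>(separated ` F) \<subseteq> separated g \<union> \<Union>(separated ` ?G)" by blast
    moreover have "finite (separated h)" for h :: "('v \<Rightarrow> nat) \<Rightarrow> real"
      by (simp add: separated_def)
    ultimately have "card (\<Union>(separated ` F)) \<le> card (separated g \<union> \<Union>(separated ` ?G))"
      using psubset.hyps by (intro card_mono) auto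
    also have "\<dots> \<le> card (separated g) + card (\<Union>(separated ` ?G))" by (rule card_Un_le)
    finally have "CARD('v) * card (\<Union>(separated ` F)) \<le>
        CARD('v) * card (separated g) + CARD('v) * card (\<Union>(separated ` ?G))"
      by (metis distrib_left mult_le_mono2)
    with orbit_bound[OF psubset.prems(1), of g] IH card_F show ?thesis by linarith
  qed simp
qed

section \<open>Geometry of the permutahedron and its extension\<close>

text \<open>The maximum is removed; it is at least \<open>card A\<close> because the elements are
  positive.\<close>

lemma sum_atLeast1_le:
  fixes A :: "nat set"
  assumes "finite A" "0 \<notin> A"
  shows "\<Sum>{1..card A} \<le> \<Sum>A"
  using assms
proof (induction "card A" arbitrary: A)
  case (Suc k)
  then have "A \<noteq> {}" by auto
  let ?M = "Max A"
  have M: "?M \<in> A" using Suc \<open>A \<noteq> {}\<close> by simp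
  have cardA: "card A = Suc (card (A - {?M}))" using M Suc by simp
  have "A \<subseteq> {1..?M}" using Suc by (auto simp: Suc_le_eq intro: gr0I)
  then have "card A \<le> ?M" using card_mono[of "{1..?M}" A] by simp
  moreover have "\<Sum>{1..card (A - {?M})} \<le> \<Sum>(A - {?M})"
    using Suc M by (intro Suc.hyps(1)) auto
  moreover have "\<Sum>A = ?M + \<Sum>(A - {?M})" using M Suc by (simp add: sum.remove)
  ultimately show ?case using cardA by simp
qed simp

definition vertex :: "('n \<Rightarrow> nat) \<Rightarrow> real^'n::finite" where
  "vertex x = (\<chi> v. real (x v))"

lemma perm_vertices_eq: "perm_vertices = vertex ` labelings"
  by (auto simp: perm_vertices_def labelings_def vertex_def vec_eq_iff image_iff)

lemma vertex_in_perm_vertices: "x \<in> labelings \<Longrightarrow> vertex x \<in> perm_vertices"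
  by (simp add: perm_vertices_eq)

lemma perm_act_vertex: "perm_act \<pi> (vertex x) = vertex (x \<circ> inv \<pi>)"
  by (simp add: perm_act_def vertex_def vec_eq_iff)

lemma sum_vertex:
  assumes "x \<in> labelings"
  shows "(\<Sum>v\<in>S. vertex x $ v) = real (\<Sum>(x ` S))"
  using inj_on_subset[OF labelings_inj[OF assms], of S] by (simp add: vertex_def sum.reindex)

text \<open>A half-space is convex, so it suffices to look at vertices, where the labels on
  \<open>S\<close> are distinct positive integers.\<close>

lemma permutahedron_facet_ineq:
  assumes "z \<in> permutahedron"
  shows "real (\<Sum>{1..card S}) \<le> (\<Sum>v\<in>S. z $ v)"
proof -
  have "convex {z. real (\<Sum>{1..card S}) \<le> (\<Sum>v\<in>S. z $ v)}"
    unfolding convex_alt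
  proof clarify
    fix x y :: "real^'a" and t :: real
    assume *: "real (\<Sum>{1..card S}) \<le> (\<Sum>v\<in>S. x $ v)" "real (\<Sum>{1..card S}) \<le> (\<Sum>v\<in>S. y $ v)"
      "0 \<le> t" "t \<le> 1"
    have "real (\<Sum>{1..card S}) = (1 - t) * real (\<Sum>{1..card S}) + t * real (\<Sum>{1..card S})"
      by (simp add: algebra_simps)
    also have "\<dots> \<le> (1 - t) * (\<Sum>v\<in>S. x $ v) + t * (\<Sum>v\<in>S. y $ v)"
      using * by (intro add_mono mult_left_mono) auto
    also have "\<dots> = (\<Sum>v\<in>S. ((1 - t) *\<^sub>R x + t *\<^sub>R y) $ v)"
      by (simp add: sum.distrib sum_distrib_left)
    finally show "real (\<Sum>{1..card S}) \<le> (\<Sum>v\<in>S. ((1 - t) *\<^sub>R x + t *\<^sub>R y) $ v)" .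
  qed
  moreover have "perm_vertices \<subseteq> {z. real (\<Sum>{1..card S}) \<le> (\<Sum>v\<in>S. z $ v)}"
  proof clarify
    fix z :: "real^'a" assume "z \<in> perm_vertices"
    then obtain x where x: "x \<in> labelings" "z = vertex x" by (auto simp: perm_vertices_eq)
    have "x v \<noteq> 0" for v using labelings_range[OF x(1), of v] by simp
    then have "0 \<notin> x ` S" by (metis imageE)
    then have "\<Sum>{1..card (x ` S)} \<le> \<Sum>(x ` S)" by (intro sum_atLeast1_le) auto
    moreover have "card (x ` S) = card S"
      using inj_on_subset[OF labelings_inj[OF x(1)], of S] by (intro card_image) auto
    ultimately show "real (\<Sum>{1..card S}) \<le> (\<Sum>v\<in>S. z $ v)"
      by (simp only: x(2) sum_vertex[OF x(1)] of_nat_le_iff)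
  qed
  ultimately show ?thesis
    using assms hull_minimal unfolding permutahedron_def by blast
qed

text \<open>If no coordinate separated the facet of \<open>S\<close> from \<open>x\<close>, one could start at the barycentre of the
  lifted facet and move slightly away from \<open>s x\<close> without leaving \<open>Q\<close>; the projection would violate
  the facet inequality.\<close>

lemma exists_separating_coordinate:
  fixes Q :: "(real^'d::finite) set" and p :: "real^'d \<Rightarrow> real^'n::finite"
  assumes ext: "subspace_extension Q p"
    and sec: "\<And>x. x \<in> perm_vertices \<Longrightarrow> s x \<in> Q \<and> p (s x) = x"
    and j: "1 \<le> j" "j < CARD('n)"
  shows "\<exists>l S x. separates (\<lambda>y. s (vertex y) $ l) j S x"
proof -
  obtain x0 :: "'n \<Rightarrow> nat" where x0: "x0 \<in> labelings"
    using finite_same_card_bij[of "UNIV :: 'n set" "{1..CARD('n)}"] by (auto simp: labelings_def)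
  define S where "S = x0 -` {1..j}"
  have S: "x0 ` S = {1..j}" "card S = j"
    using labelings_vimage[OF x0, of j] j by (auto simp: S_def)
  \<comment> \<open>Exchanging the labels \<open>j\<close> and \<open>j + 1\<close> gives a vertex
    next to the facet of \<open>S\<close>.\<close>
  define x1 where "x1 = swap j (Suc j) \<circ> x0"
  have x1: "x1 \<in> labelings"
    using x0 j permutes_imp_bij[OF permutes_swap_id[of j "{1..CARD('n)}" "Suc j"]]
    by (auto simp: x1_def labelings_def intro: bij_betw_trans)
  have x1S: "x1 ` S = insert (Suc j) {1..<j}"
  proof -
    have "swap j (Suc j) ` {1..<j} = {1..<j}" by (auto simp: Transposition.transpose_def image_iff)
    moreover have "{1..j} = insert j {1..<j}" using j by auto
    moreover have "x1 ` S = swap j (Suc j) ` {1..j}" by (simp only: x1_def image_comp[symmetric] S)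
    ultimately show ?thesis by simp
  qed
  obtain A where A: "affine A" "Q = A \<inter> {y. \<forall>i. 0 \<le> y $ i}" and lin: "linear p"
    and pQ: "p ` Q = permutahedron"
    using ext by (auto simp: subspace_extension_def)
  define L where "L = {y \<in> labelings. y ` S = {1..j}}"
  have "finite (labelings :: ('n \<Rightarrow> nat) set)"
  proof (rule finite_subset)
    show "labelings \<subseteq> Pi\<^sub>E (UNIV :: 'n set) (\<lambda>_. {1..CARD('n)})"
      unfolding PiE_UNIV_domain using labelings_range by blast
  qed (intro finite_PiE; simp)
  then have finL: "finite L" by (simp add: L_def)
  have x0L: "x0 \<in> L" using x0 S by (simp add: L_def)
  have sQ: "s (vertex y) \<in> Q" "p (s (vertex y)) = vertex y" if "y \<in> labelings" for y
    using sec[OF vertex_in_perm_vertices[OF that]] by auto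
  then have nonneg: "0 \<le> s (vertex y) $ l" and sA: "s (vertex y) \<in> A" if "y \<in> labelings" for y l
    using that A(2) by auto
  define N where "N = real (card L)"
  have N: "N > 0" using x0L finL by (auto simp: N_def card_gt_0_iff)
  define q where "q = (\<Sum>y\<in>L. (1 / N) *\<^sub>R s (vertex y))"
  have qA: "q \<in> A"
    unfolding q_def
  proof (rule convex_sum[OF finL affine_imp_convex[OF A(1)]])
    show "(\<Sum>y\<in>L. 1 / N) = 1" using N by (simp add: N_def)
  qed (use N sA in \<open>auto simp: L_def\<close>)
  have q_nth: "q $ l = (\<Sum>y\<in>L. s (vertex y) $ l) / N" for l
    by (simp add: q_def sum_divide_distrib)
  show ?thesis
  proof (rule ccontr)
    assume none: "\<not> ?thesis"
    \<comment> \<open>Coordinates of lifted vertices are nonnegative, so one that vanishes at the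
      barycentre \<open>q\<close> vanishes on the whole lifted facet and, without separation, also
      at \<open>x1\<close>.\<close>
    have q0: "s (vertex x1) $ l = 0" if "q $ l = 0" for l
    proof -
      have "(\<Sum>y\<in>L. s (vertex y) $ l) = 0" using that N by (simp add: q_nth)
      then have "\<forall>y\<in>L. s (vertex y) $ l = 0"
        using finL nonneg by (subst (asm) sum_nonneg_eq_0_iff) (auto simp: L_def)
      with none x1 x1S S(2) show ?thesis unfolding separates_def L_def by blast
    qed
    define r where "r = s (vertex x1)"
    have r: "0 \<le> r $ l" "q $ l = 0 \<Longrightarrow> r $ l = 0" for l using nonneg[OF x1] q0 by (auto simp: r_def)
    have q_nn: "0 \<le> q $ l" for l
      using N nonneg by (auto simp: q_nth L_def intro!: divide_nonneg_pos sum_nonneg)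
    \<comment> \<open>The sum bounds every ratio \<open>r $ l / q $ l\<close>, and the added one
      makes \<open>C\<close> positive. Where \<open>q $ l = 0\<close>, the ratio is zero by
      convention and \<open>r $ l\<close> vanishes too.\<close>
    define C where "C = 1 + (\<Sum>l\<in>UNIV. r $ l / q $ l)"
    have C: "C > 0"
      using r(1) q_nn by (auto simp: C_def intro!: add_pos_nonneg sum_nonneg divide_nonneg_nonneg)
    have rC: "r $ l \<le> C * q $ l" for l
    proof (cases "q $ l = 0")
      case False
      then have "q $ l > 0" using q_nn[of l] by simp
      have "r $ l / q $ l \<le> (\<Sum>l\<in>UNIV. r $ l / q $ l)"
        using r(1) q_nn by (intro member_le_sum) auto
      also have "\<dots> \<le> C" by (simp add: C_def)
      finally show ?thesis using \<open>q $ l > 0\<close> by (simp add: pos_divide_le_eq)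
    qed (use r in simp)
    \<comment> \<open>The coefficients sum to one, which keeps \<open>z\<close> in the affine space;
      \<open>rC\<close> keeps it nonnegative.\<close>
    define z where "z = (1 + 1 / C) *\<^sub>R q + (- (1 / C)) *\<^sub>R r"
    have "z \<in> A" unfolding z_def r_def by (rule mem_affine[OF A(1) qA sA[OF x1]]) simp
    moreover have "0 \<le> z $ l" for l
    proof -
      have "z $ l = (q $ l + (C * q $ l - r $ l)) / C" using C by (simp add: z_def field_simps)
      then show ?thesis using q_nn[of l] rC[of l] C by simp
    qed
    ultimately have "z \<in> Q" using A(2) by blast
    then have "p z \<in> permutahedron" using pQ by blast
    then have facet: "real (\<Sum>{1..j}) \<le> (\<Sum>v\<in>S. p z $ v)"
      using permutahedron_facet_ineq[of "p z" S] S(2) by simp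
    have "p z = (1 + 1 / C) *\<^sub>R p q + (- (1 / C)) *\<^sub>R p r"
      unfolding z_def by (simp only: linear_add[OF lin] linear_scale[OF lin])
    then have "p z $ v = (1 + 1 / C) * p q $ v - 1 / C * p r $ v" for v by simp
    then have "(\<Sum>v\<in>S. p z $ v) = (1 + 1 / C) * (\<Sum>v\<in>S. p q $ v) - 1 / C * (\<Sum>v\<in>S. p r $ v)"
      by (simp only: sum_subtractf sum_distrib_left)
    \<comment> \<open>The slack of one at \<open>x1\<close> turns into a violation by
      \<open>1 / C\<close> at \<open>p z\<close>.\<close>
    moreover have "(\<Sum>v\<in>S. p r $ v) = real (\<Sum>{1..j}) + 1"
    proof -
      have "\<Sum>(insert (Suc j) {1..<j}) = \<Sum>(insert j {1..<j}) + 1" by simp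
      also have "insert j {1..<j} = {1..j}" using j by auto
      finally show ?thesis
        using sum_vertex[OF x1, of S] by (simp only: r_def sQ(2)[OF x1] x1S)
    qed
    moreover have "(\<Sum>v\<in>S. p q $ v) = real (\<Sum>{1..j})"
    proof -
      have "p q = (\<Sum>y\<in>L. (1 / N) *\<^sub>R p (s (vertex y)))"
        unfolding q_def by (simp only: linear_sum[OF lin] linear_scale[OF lin])
      also have "\<dots> = (\<Sum>y\<in>L. (1 / N) *\<^sub>R vertex y)"
        using sQ(2) by (intro sum.cong) (auto simp: L_def)
      finally have "(\<Sum>v\<in>S. p q $ v) = (\<Sum>v\<in>S. \<Sum>y\<in>L. 1 / N * vertex y $ v)" by simp
      also have "\<dots> = (\<Sum>y\<in>L. 1 / N * (\<Sum>v\<in>S. vertex y $ v))"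
        by (subst sum.swap) (simp add: sum_distrib_left)
      also have "\<dots> = (\<Sum>y\<in>L. 1 / N * real (\<Sum>{1..j}))"
        by (intro sum.cong refl) (auto simp: L_def sum_vertex)
      also have "\<dots> = real (\<Sum>{1..j})" using N by (simp add: N_def)
      finally show ?thesis .
    qed
    ultimately have "(\<Sum>v\<in>S. p z $ v) = real (\<Sum>{1..j}) - 1 / C"
      by (simp only:) (simp add: algebra_simps)
    moreover have "1 / C > 0" using C by simp
    ultimately show False using facet by linarith
  qed
qed

section \<open>Lower bound on the size of a weakly symmetric extension\<close>

text \<open>The coordinates of the section form at most \<open>CARD('d)\<close> functions on
  labelings, closed under translation by weak symmetry. All \<open>CARD('n) - 1\<close> indices are
  separated, so either alternative of \<open>separated_bound\<close> gives the claim.\<close>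

lemma weakly_symmetric_extension_size:
  fixes Q :: "(real^'d::finite) set" and p :: "real^'d \<Rightarrow> real^'n::finite"
  assumes n: "3 \<le> CARD('n)" and ext: "subspace_extension Q p"
    and sym: "weakly_symmetric_section Q p s"
  shows "CARD('n) * (CARD('n) - 1) \<le> 2 * CARD('d)"
proof -
  define comp where "comp = (\<lambda>l. restrict (\<lambda>x. s (vertex x) $ l) labelings)"
  have closed: "translate g \<pi> \<in> range comp" if g: "g \<in> range comp" and \<pi>: "\<pi> permutes UNIV" for g \<pi>
  proof -
    obtain l where l: "g = comp l" using g by blast
    \<comment> \<open>\<open>translate\<close> composes with \<open>\<pi>\<close> but
      \<open>perm_act\<close> with the inverse of its argument, hence
      \<open>inv \<pi>\<close>.\<close>
    obtain \<kappa> where \<kappa>: "\<kappa> permutes UNIV"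
      "\<And>x. x \<in> perm_vertices \<Longrightarrow> s (perm_act (inv \<pi>) x) = perm_act \<kappa> (s x)"
      using sym permutes_inv[OF \<pi>] unfolding weakly_symmetric_section_def by blast
    have "translate g \<pi> x = comp (inv \<kappa> l) x" for x
    proof (cases "x \<in> labelings")
      case True
      have "translate g \<pi> x = s (vertex (x \<circ> \<pi>)) $ l"
        using True labelings_comp[OF True \<pi>] by (simp add: translate_def l comp_def)
      also have "vertex (x \<circ> \<pi>) = perm_act (inv \<pi>) (vertex x)"
        by (simp add: perm_act_vertex permutes_inv_inv[OF \<pi>])
      also have "s \<dots> $ l = comp (inv \<kappa> l) x"
        using True unfolding \<kappa>(2)[OF vertex_in_perm_vertices[OF True]]
        by (simp add: perm_act_def comp_def)
      finally show ?thesis .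
    qed (simp add: translate_def comp_def)
    then show ?thesis by blast
  qed
  have "{1..<CARD('n)} \<subseteq> \<Union>(separated ` range comp)"
  proof
    fix j assume j: "j \<in> {1..<CARD('n)}"
    then obtain l S x where "separates (\<lambda>y. s (vertex y) $ l) j S x"
      using exists_separating_coordinate[OF ext, of s j] sym
      unfolding weakly_symmetric_section_def by auto
    then have "separates (comp l) j S x" by (auto simp: separates_def comp_def)
    with j have "j \<in> separated (comp l)" by (auto simp: separated_def)
    then show "j \<in> \<Union>(separated ` range comp)" by blast
  qed
  then have "card {1..<CARD('n)} \<le> card (\<Union>(separated ` range comp))"
    by (intro card_mono) (auto simp: separated_def)
  then have "CARD('n) * (CARD('n) - 1) \<le> CARD('n) * card (\<Union>(separated ` range comp))"
    by (intro mult_left_mono) auto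
  moreover have "CARD('n) * card (\<Union>(separated ` range comp)) \<le> 2 * card (range comp) \<or>
      CARD('n) * (CARD('n) - 1) \<le> 2 * card (range comp)"
    using closed by (intro separated_bound n) (auto simp: comp_def)
  moreover have "card (range comp) \<le> CARD('d)" by (rule card_image_le) simp
  ultimately show ?thesis by linarith
qed

theorem theorem6:
  fixes Q :: "(real^'d::finite) set"
    and p :: "real^'d \<Rightarrow> real^'n::finite"
    and s :: "real^'n \<Rightarrow> real^'d"
  assumes "CARD('n) \<ge> 6"
    and "2 * CARD('d) < CARD('n) * (CARD('n) - 1)"
    and "subspace_extension Q p"
    and "weakly_symmetric_section Q p s"
  shows "\<exists>(k::nat) (m::nat) (a :: nat \<Rightarrow> 'n \<Rightarrow> 'd) (b :: nat \<Rightarrow> 'd).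
           bij_betw (case_sum (\<lambda>(i, t). a i t) b) (({..<k} \<times> (UNIV::'n set)) <+> {..<m}) (UNIV::'d set) \<and>
           (\<forall>x\<in>perm_vertices. \<forall>\<pi>. \<pi> permutes (UNIV::'n set) \<and> evenperm \<pi> \<longrightarrow>
              (\<forall>i<k. \<forall>t. s (perm_act \<pi> x) $ a i t = s x $ a i (inv \<pi> t)) \<and>
              (\<forall>j<m. s (perm_act \<pi> x) $ b j = s x $ b j))"
  using weakly_symmetric_extension_size[OF _ assms(3,4)] assms(1,2) by simp

end
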